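(* Let $k$ be a field of characteristic zero. The $\underline 2$-ramified partition algebra $P_n^{(\underline 2)}(\mathbf Q)$ is generically semisimple for all $n$: for each $n\ge1$ there is a nonzero polynomial $f_n\in k[x_1,x_2]$ such that $P_n^{(\underline 2)}(\mathbf Q)$ is a semisimple algebra for every $\mathbf Q=(Q_1,Q_2)\in k^2$ with $f_n(Q_1,Q_2)\ne0$.
   Context: Write $\underline n=\{1,\ldots,n\}$, and let $\underline n'$, $\underline n''$ be disjoint (primed, doubly primed) copies. $p_n$ is the set of partitions of $\underline n\cup\underline n'$ (identified with equivalence relations). For $a,b\in p_n$ let $b^{+}$ be the partition of $\underline n'\cup\underline n''$ obtained from $b$ by renaming $i\mapsto i'$, $i'\mapsto i''$; let $d_u(ab)$ be the equivalence relation on $\underline n\cup\underline n'\cup\underline n''$ generated by $a$ and $b^{+}$; $c(a,b)$ is the number of parts of $d_u(ab)$ contained in $\underline n'$; $d(ab)\in p_n$ is obtained by restricting $d_u(ab)$ to $\underline n\cup\underline n''$ and renaming $i''\mapsto i'$. $p_n^{(\underline 2)}$ is the set of pairs $(a_1,a_2)\in p_n\times p_n$ such that $a_1$ is a refinement of $a_2$, i.e. each part of $a_2$ is a union of parts of $a_1$. For $\mathbf Q=(Q_1,Q_2)\in k^2$, $P_n^{(\underline 2)}(\mathbf Q)$ is the (unital, associative) $k$-algebra with basis $p_n^{(\underline 2)}$ and product $ab=Q_1^{c(a_1,b_1)}Q_2^{c(a_2,b_2)}(d(a_1b_1),d(a_2b_2))$. *)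

theory Defs
  imports
    "HOL-Algebra.Algebra"
    "HOL-Algebra.Algebraic_Closure_Type"
    "HOL-Computational_Algebra.Polynomial"
begin

section \<open>Semisimple algebras\<close>

definition left_ideal :: "'b set \<Rightarrow> ('b, 'm) ring_scheme \<Rightarrow> bool" where
  "left_ideal I R \<longleftrightarrow> additive_subgroup I R \<and>
     (\<forall>r\<in>carrier R. \<forall>x\<in>I. r \<otimes>\<^bsub>R\<^esub> x \<in> I)"

text \<open>The simple submodules of the left regular module.\<close>

definition simple_left_ideal :: "'b set \<Rightarrow> ('b, 'm) ring_scheme \<Rightarrow> bool" where
  "simple_left_ideal I R \<longleftrightarrow> left_ideal I R \<and> I \<noteq> {\<zero>\<^bsub>R\<^esub>} \<and>
     (\<forall>J. left_ideal J R \<longrightarrow> J \<subseteq> I \<longrightarrow> J = {\<zero>\<^bsub>R\<^esub>} \<or> J = I)"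

text \<open>
  The left regular module is a direct sum of simple submodules. For a unital ring such a direct
  sum has only finitely many summands. Distinct summands of a direct sum are distinct sets, so
  they may be indexed by themselves.
\<close>

definition semisimple_ring :: "('b, 'm) ring_scheme \<Rightarrow> bool" where
  "semisimple_ring R \<longleftrightarrow> ring R \<and>
     (\<exists>S. finite S \<and> (\<forall>I\<in>S. simple_left_ideal I R) \<and>
        (\<forall>x\<in>carrier R. \<exists>!g. g \<in> (\<Pi>\<^sub>E I\<in>S. I) \<and> x = (\<Oplus>\<^bsub>R\<^esub>I\<in>S. g I)))"

text \<open>The library's locale \<open>algebra\<close> is restricted to commutative algebras.\<close>

definition assoc_unital_algebra :: "('a, 'n) ring_scheme \<Rightarrow> ('a, 'b, 'm) module_scheme \<Rightarrow> bool" where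
  "assoc_unital_algebra K A \<longleftrightarrow> module K A \<and> ring A \<and>
     (\<forall>c\<in>carrier K. \<forall>x\<in>carrier A. \<forall>y\<in>carrier A.
        (c \<odot>\<^bsub>A\<^esub> x) \<otimes>\<^bsub>A\<^esub> y = c \<odot>\<^bsub>A\<^esub> (x \<otimes>\<^bsub>A\<^esub> y) \<and>
        x \<otimes>\<^bsub>A\<^esub> (c \<odot>\<^bsub>A\<^esub> y) = c \<odot>\<^bsub>A\<^esub> (x \<otimes>\<^bsub>A\<^esub> y))"

text \<open>
  Left ideals of a unital algebra are closed under scalars, since \<open>c \<odot> x = (c \<odot> \<one>) \<otimes> x\<close>; hence
  semisimplicity as an algebra is semisimplicity of the underlying ring.
\<close>

definition semisimple_algebra :: "('a, 'n) ring_scheme \<Rightarrow> ('a, 'b, 'm) module_scheme \<Rightarrow> bool" where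
  "semisimple_algebra K A \<longleftrightarrow> assoc_unital_algebra K A \<and> semisimple_ring A"


section \<open>Partitions and their composition\<close>

text \<open>
  The vertex \<open>i\<close> carrying \<open>l\<close> primes is encoded as the pair \<open>(i, l)\<close>. Partitions are represented
  by equivalence relations; the parts of \<open>r\<close> on \<open>V\<close> are the elements of the quotient \<open>V // r\<close>.
\<close>

type_synonym vertex = "nat \<times> nat"

definition row :: "nat \<Rightarrow> nat \<Rightarrow> vertex set" where
  "row n l = {1..n} \<times> {l}"

definition partitions :: "nat \<Rightarrow> vertex rel set" where
  "partitions n = {r. equiv (row n 0 \<union> row n 1) r}"

definition relabel :: "(vertex \<Rightarrow> vertex) \<Rightarrow> vertex rel \<Rightarrow> vertex rel" where
  "relabel f r = map_prod f f ` r"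

text \<open>The partition \<open>b\<^sup>+\<close>, with \<open>i \<mapsto> i'\<close> and \<open>i' \<mapsto> i''\<close>.\<close>

definition shift :: "vertex rel \<Rightarrow> vertex rel" where
  "shift b = relabel (\<lambda>(i, l). (i, Suc l)) b"

definition generated_equiv :: "'a set \<Rightarrow> 'a rel \<Rightarrow> 'a rel" where
  "generated_equiv V r = \<Inter>{s. equiv V s \<and> r \<subseteq> s}"

definition joined_partition :: "nat \<Rightarrow> vertex rel \<Rightarrow> vertex rel \<Rightarrow> vertex rel" where
  "joined_partition n a b = generated_equiv (row n 0 \<union> row n 1 \<union> row n 2) (a \<union> shift b)"

definition middle_parts :: "nat \<Rightarrow> vertex rel \<Rightarrow> vertex rel \<Rightarrow> nat" where
  "middle_parts n a b =
     card {P \<in> (row n 0 \<union> row n 1 \<union> row n 2) // joined_partition n a b. P \<subseteq> row n 1}"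

definition partition_comp :: "nat \<Rightarrow> vertex rel \<Rightarrow> vertex rel \<Rightarrow> vertex rel" where
  "partition_comp n a b =
     relabel (\<lambda>(i, l). (i, if l = 2 then 1 else l))
       (joined_partition n a b \<inter> ((row n 0 \<union> row n 2) \<times> (row n 0 \<union> row n 2)))"

definition is_refinement :: "nat \<Rightarrow> vertex rel \<Rightarrow> vertex rel \<Rightarrow> bool" where
  "is_refinement n a1 a2 \<longleftrightarrow>
     (\<forall>P \<in> (row n 0 \<union> row n 1) // a2. \<exists>C \<subseteq> (row n 0 \<union> row n 1) // a1. P = \<Union>C)"

definition ramified_partitions :: "nat \<Rightarrow> (vertex rel \<times> vertex rel) set" where
  "ramified_partitions n =
     {(a1, a2). a1 \<in> partitions n \<and> a2 \<in> partitions n \<and> is_refinement n a1 a2}"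

text \<open>The partition with parts \<open>{i, i'}\<close>.\<close>

definition identity_partition :: "nat \<Rightarrow> vertex rel" where
  "identity_partition n =
     {(x, y). x \<in> row n 0 \<union> row n 1 \<and> y \<in> row n 0 \<union> row n 1 \<and> fst x = fst y}"


section \<open>The ramified partition algebra\<close>

text \<open>
  An element is its coefficient function with respect to the basis \<open>ramified_partitions n\<close>, extended by zero
  outside the basis.
\<close>

definition ramified_mult ::
  "nat \<Rightarrow> 'k::field \<Rightarrow> 'k \<Rightarrow> (vertex rel \<times> vertex rel \<Rightarrow> 'k) \<Rightarrow> (vertex rel \<times> vertex rel \<Rightarrow> 'k) \<Rightarrow>
     (vertex rel \<times> vertex rel \<Rightarrow> 'k)" where
  "ramified_mult n Q1 Q2 f g = (\<lambda>d.
     \<Sum>(a1, a2)\<in>ramified_partitions n. \<Sum>(b1, b2)\<in>ramified_partitions n.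
       if d = (partition_comp n a1 b1, partition_comp n a2 b2)
       then f (a1, a2) * g (b1, b2) * (Q1 ^ middle_parts n a1 b1 * Q2 ^ middle_parts n a2 b2)
       else 0)"

definition ramified_partition_algebra ::
  "nat \<Rightarrow> 'k::field \<Rightarrow> 'k \<Rightarrow> ('k, vertex rel \<times> vertex rel \<Rightarrow> 'k) module" where
  "ramified_partition_algebra n Q1 Q2 =
     \<lparr>carrier = {f. \<forall>d. d \<notin> ramified_partitions n \<longrightarrow> f d = 0},
      monoid.mult = ramified_mult n Q1 Q2,
      one = (\<lambda>d. if d = (identity_partition n, identity_partition n) then 1 else 0),
      ring.zero = (\<lambda>d. 0),
      add = (\<lambda>f g d. f d + g d),
      module.smult = (\<lambda>c f d. c * f d)\<rparr>"

end

(*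
Colour the vertices with N colours. A partition acts on words of length n over the colours by the
0/1 matrix of its compatible colourings, and composition becomes matrix multiplication up to the
weights. For N >= 2n every partition is the kernel of a colouring, so the matrices of (ramified)
partitions are linearly independent; this yields associativity and, since the set of matrices is
closed under transposition, positivity: at Q1 = Q2 = N the trace form of the regular
representation over the reals is nondegenerate. Its Gram determinant is a polynomial in Q1, Q2 with
integer coefficients, hence not the zero polynomial over k. Wherever it does not vanish, the
inverse Gram matrix provides a Casimir element; averaging a projection onto a left ideal over it
shows that every left ideal is generated by an idempotent, which gives semisimplicity.
*)

theory Submission
  imports Defs "HOL-Library.Function_Algebras" "Jordan_Normal_Form.Determinant"
begin

hide_const (open) Matrix.row
hide_fact (open) Matrix.row_def

section \<open>Partitions and colourings\<close>

text \<open>The matrices exist only for natural parameters and positivity needs an ordered field,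
  while \<open>k\<close> need not be ordered. So nondegeneracy is proved at a single point over the
  reals, and the integrality of the determinant there carries it to \<open>k\<close>.

  Positivity rests on adjoints. For the Frobenius inner product on the span of the matrices, the
  adjoint of left multiplication by \<open>v\<close> is left multiplication by the transpose of
  \<open>v\<close>, which stays in the span. If \<open>v\<close> lies in the radical of the trace
  form, the trace of this adjoint composed with left multiplication by \<open>v\<close> is zero;
  hence left multiplication by \<open>v\<close> vanishes, and so does \<open>v = v 1\<close>. The
  basis of partitions is not orthogonal, so the inverse of its Gram matrix has to enter the
  computation.

  The bound \<open>2 * n\<close> is the number of vertices of a diagram, which limits the number of
  parts. No structure theory of algebras is used: the idempotent generating a left ideal provides a
  complement, and an induction on dimension splits the algebra into simple left ideals.\<close>

definition constant_on_parts :: "'a rel \<Rightarrow> ('a \<Rightarrow> 'c) \<Rightarrow> bool" where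
  "constant_on_parts r h \<longleftrightarrow> (\<forall>(x, y)\<in>r. h x = h y)"

lemma constant_on_parts_Un [simp]: "constant_on_parts (r \<union> s) h \<longleftrightarrow> constant_on_parts r h \<and> constant_on_parts s h"
  by (auto simp: constant_on_parts_def)

lemma constant_on_parts_mono: "r \<subseteq> s \<Longrightarrow> constant_on_parts s h \<Longrightarrow> constant_on_parts r h"
  by (auto simp: constant_on_parts_def)

lemma constant_on_parts_relabel: "constant_on_parts (relabel f r) h \<longleftrightarrow> constant_on_parts r (h \<circ> f)"
  by (force simp: constant_on_parts_def relabel_def)

lemma constant_on_parts_cong:
  "r \<subseteq> V \<times> V \<Longrightarrow> (\<And>x. x \<in> V \<Longrightarrow> h x = k x) \<Longrightarrow> constant_on_parts r h \<longleftrightarrow> constant_on_parts r k"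
  unfolding constant_on_parts_def by fastforce

lemma constant_on_partsD: "constant_on_parts r h \<Longrightarrow> (x, y) \<in> r \<Longrightarrow> h x = h y"
  by (auto simp: constant_on_parts_def)

lemma equiv_kernel: "equiv V {(x, y). x \<in> V \<and> y \<in> V \<and> h x = h y}"
  by (auto intro!: equivI refl_onI symI transI)

lemma equiv_generated_equiv:
  assumes "r \<subseteq> V \<times> V"
  shows "equiv V (generated_equiv V r)"
proof (rule equivI)
  \<comment> \<open>The full relation belongs to the family, so the intersection is not over an
    empty family and stays inside \<open>V \<times> V\<close>.\<close>
  have "equiv V (V \<times> V)"
    by (auto intro!: equivI refl_onI symI transI)
  then show "generated_equiv V r \<subseteq> V \<times> V"
    using assms unfolding generated_equiv_def by blast
  show "refl_on V (generated_equiv V r)"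
    unfolding generated_equiv_def by (auto intro!: refl_onI elim!: equivE dest: refl_onD)
  show "sym (generated_equiv V r)"
  proof (rule symI)
    fix x y assume "(x, y) \<in> generated_equiv V r"
    then have "(y, x) \<in> s" if "equiv V s" "r \<subseteq> s" for s
      using that unfolding generated_equiv_def by (blast elim: equivE dest: symD)
    then show "(y, x) \<in> generated_equiv V r"
      unfolding generated_equiv_def by blast
  qed
  show "trans (generated_equiv V r)"
  proof (rule transI)
    fix x y z assume "(x, y) \<in> generated_equiv V r" "(y, z) \<in> generated_equiv V r"
    then have "(x, z) \<in> s" if "equiv V s" "r \<subseteq> s" for s
      using that unfolding generated_equiv_def by (blast elim: equivE dest: transD)
    then show "(x, z) \<in> generated_equiv V r"
      unfolding generated_equiv_def by blast
  qed
qed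

lemma generated_equiv_superset: "r \<subseteq> generated_equiv V r"
  unfolding generated_equiv_def by blast

lemma generated_equiv_minimal: "equiv V s \<Longrightarrow> r \<subseteq> s \<Longrightarrow> generated_equiv V r \<subseteq> s"
  unfolding generated_equiv_def by blast

lemma generated_equiv_mono: "r \<subseteq> s \<Longrightarrow> generated_equiv V r \<subseteq> generated_equiv V s"
  unfolding generated_equiv_def by blast

text \<open>The kernel of \<open>h\<close> is itself an equivalence relation, so once it contains
  \<open>r\<close> it contains the relation generated by \<open>r\<close>. This is why partitions
  are studied through colourings: generating an equivalence relation becomes invisible.\<close>

lemma constant_on_parts_generated_equiv:
  assumes "r \<subseteq> V \<times> V"
  shows "constant_on_parts (generated_equiv V r) h \<longleftrightarrow> constant_on_parts r h"
proof
  assume "constant_on_parts r h"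
  then have "generated_equiv V r \<subseteq> {(x, y). x \<in> V \<and> y \<in> V \<and> h x = h y}"
    using assms by (intro generated_equiv_minimal equiv_kernel) (auto simp: constant_on_parts_def)
  then show "constant_on_parts (generated_equiv V r) h"
    by (auto simp: constant_on_parts_def)
qed (rule constant_on_parts_mono[OF generated_equiv_superset])

lemma equiv_relabel:
  assumes r: "equiv U r" and inj: "inj_on f U"
  shows "equiv (f ` U) (relabel f r)"
proof (rule equivI)
  have sub: "r \<subseteq> U \<times> U" using r by (auto elim: equivE)
  show "relabel f r \<subseteq> f ` U \<times> f ` U"
    using sub by (auto simp: relabel_def)
  show "refl_on (f ` U) (relabel f r)"
  proof (rule refl_onI)
    fix y assume "y \<in> f ` U"
    then obtain x where "x \<in> U" "y = f x" by blast
    with r show "(y, y) \<in> relabel f r"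
      unfolding relabel_def by (intro image_eqI[of _ _ "(x, x)"]) (auto elim: equivE dest: refl_onD)
  qed
  show "sym (relabel f r)"
    using r by (force simp: relabel_def elim!: equivE dest: symD intro!: symI)
  show "trans (relabel f r)"
  proof (rule transI)
    fix x y z assume "(x, y) \<in> relabel f r" "(y, z) \<in> relabel f r"
    then obtain a b c d where *: "(a, b) \<in> r" "(c, d) \<in> r" "x = f a" "y = f b" "y = f c" "z = f d"
      by (auto simp: relabel_def)
    \<comment> \<open>Transitivity is where injectivity enters: the two preimages of the middle
      vertex must coincide.\<close>
    have "b = c"
      using * sub inj by (auto dest: inj_onD)
    with * r have "(a, d) \<in> r"
      by (auto elim!: equivE dest: transD)
    with * show "(x, z) \<in> relabel f r"
      by (force simp: relabel_def)
  qed
qed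

lemma equiv_restrict:
  assumes "equiv V r" "U \<subseteq> V"
  shows "equiv U (r \<inter> U \<times> U)"
  using assms by (auto elim!: equivE intro!: equivI refl_onI symI transI dest: refl_onD symD transD)

text \<open>Turns a condition on parts into inclusion of relations, for which composition and
  reflection are visibly monotone.\<close>

lemma is_refinement_iff_subset:
  assumes "a1 \<in> partitions n" "a2 \<in> partitions n"
  shows "is_refinement n a1 a2 \<longleftrightarrow> a1 \<subseteq> a2"
proof -
  let ?V = "row n 0 \<union> row n 1"
  have e: "equiv ?V a1" "equiv ?V a2"
    using assms by (auto simp: partitions_def)
  show ?thesis
  proof
    assume ref: "is_refinement n a1 a2"
    show "a1 \<subseteq> a2"
    proof (rule subrelI)
      fix x y assume xy: "(x, y) \<in> a1"
      then have x: "x \<in> ?V"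
        using e(1) by (auto elim!: equivE)
      then have P: "a2 `` {x} \<in> ?V // a2" by (rule quotientI)
      then obtain C where C: "C \<subseteq> ?V // a1" "a2 `` {x} = \<Union>C"
        using ref unfolding is_refinement_def by blast
      have "x \<in> a2 `` {x}" using x e(2) by (rule equiv_class_self[rotated])
      then obtain D where D: "D \<in> C" "x \<in> D" using C by blast
      then obtain z where z: "D = a1 `` {z}" using C by (auto elim!: quotientE)
      then have "y \<in> D" using D(2) xy e(1) by (auto elim!: equivE dest: transD)
      then have "y \<in> a2 `` {x}" using C D by blast
      then show "(x, y) \<in> a2" by simp
    qed
  next
    assume sub: "a1 \<subseteq> a2"
    show "is_refinement n a1 a2"
      unfolding is_refinement_def
    proof
      fix P assume P: "P \<in> ?V // a2"
      then have PV: "P \<subseteq> ?V" using e(2) by (auto elim!: quotientE equivE)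
      have "P = \<Union>((\<lambda>x. a1 `` {x}) ` P)"
      proof
        show "P \<subseteq> \<Union>((\<lambda>x. a1 `` {x}) ` P)"
        proof
          fix x assume x: "x \<in> P"
          then have "x \<in> a1 `` {x}" using PV by (intro equiv_class_self[OF e(1)]) auto
          then show "x \<in> \<Union>((\<lambda>x. a1 `` {x}) ` P)" using x by blast
        qed
        show "\<Union>((\<lambda>x. a1 `` {x}) ` P) \<subseteq> P"
          using P e(2) sub by (auto elim!: quotientE equivE dest: transD)
      qed
      moreover have "(\<lambda>x. a1 `` {x}) ` P \<subseteq> ?V // a1"
        using PV by (auto intro: quotientI)
      ultimately show "\<exists>C\<subseteq>?V // a1. P = \<Union>C" by blast
    qed
  qed
qed

lemma ramified_partitions_eq:
  "ramified_partitions n = {(a1, a2). a1 \<in> partitions n \<and> a2 \<in> partitions n \<and> a1 \<subseteq> a2}"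
  by (auto simp: ramified_partitions_def is_refinement_iff_subset)

section \<open>Matrices of partitions and the counting of compatible middle words\<close>

definition colouring :: "(nat \<Rightarrow> 'c) \<Rightarrow> (nat \<Rightarrow> 'c) \<Rightarrow> vertex \<Rightarrow> 'c" where
  "colouring \<alpha> \<beta> = (\<lambda>(i, l). if l = 0 then \<alpha> i else \<beta> i)"

definition colouring3 :: "(nat \<Rightarrow> 'c) \<Rightarrow> (nat \<Rightarrow> 'c) \<Rightarrow> (nat \<Rightarrow> 'c) \<Rightarrow> vertex \<Rightarrow> 'c" where
  "colouring3 \<alpha> \<gamma> \<beta> = (\<lambda>(i, l). if l = 0 then \<alpha> i else if l = 1 then \<gamma> i else \<beta> i)"

text \<open>Extensional functions, so that there are finitely many words and two words agreeing on
  \<open>{1..n}\<close> are equal.\<close>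

definition words :: "nat \<Rightarrow> nat \<Rightarrow> (nat \<Rightarrow> nat) set" where
  "words n N = ({1..n} \<rightarrow>\<^sub>E {..<N})"

lemma finite_words [simp]: "finite (words n N)"
  unfolding words_def by (auto intro: finite_PiE)

text \<open>The entry at \<open>(\<alpha>, \<beta>)\<close> of the matrix by which \<open>a\<close> acts on the \<open>n\<close>-th tensor power of an
  \<open>N\<close>-dimensional space with a chosen basis.\<close>

definition entry :: "vertex rel \<Rightarrow> (nat \<Rightarrow> nat) \<Rightarrow> (nat \<Rightarrow> nat) \<Rightarrow> bool" where
  "entry a \<alpha> \<beta> \<longleftrightarrow> constant_on_parts a (colouring \<alpha> \<beta>)"

lemma partitions_subset:
  "a \<in> partitions n \<Longrightarrow> a \<subseteq> (row n 0 \<union> row n 1) \<times> (row n 0 \<union> row n 1)"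
  by (auto simp: partitions_def elim!: equivE)

lemma finite_row [simp]: "finite (row n l)"
  by (simp add: row_def)

lemma finite_partitions [simp]: "finite (partitions n)"
  by (rule finite_subset[of _ "Pow ((row n 0 \<union> row n 1) \<times> (row n 0 \<union> row n 1))"])
    (use partitions_subset in auto)

lemma finite_ramified_partitions [simp]: "finite (ramified_partitions n)"
  by (rule finite_subset[of _ "partitions n \<times> partitions n"]) (auto simp: ramified_partitions_def)

lemma shift_subset:
  "b \<in> partitions n \<Longrightarrow> shift b \<subseteq> (row n 1 \<union> row n 2) \<times> (row n 1 \<union> row n 2)"
  unfolding shift_def relabel_def by (fastforce dest!: partitions_subset simp: row_def)

lemma joined_partition_equiv:
  assumes "a \<in> partitions n" "b \<in> partitions n"
  shows "equiv (row n 0 \<union> row n 1 \<union> row n 2) (joined_partition n a b)"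
  unfolding joined_partition_def
  using partitions_subset[OF assms(1)] shift_subset[OF assms(2)]
  by (intro equiv_generated_equiv) blast

text \<open>The generated relation has the same compatible colourings as its generators
  \<open>a\<close> and \<open>shift b\<close>, and each generator sees only two of the three rows.
  An entry of a matrix product therefore counts the middle words compatible with the join.\<close>

lemma constant_on_parts_joined_partition:
  assumes "a \<in> partitions n" "b \<in> partitions n"
  shows "constant_on_parts (joined_partition n a b) (colouring3 \<alpha> \<gamma> \<beta>) \<longleftrightarrow> entry a \<alpha> \<gamma> \<and> entry b \<gamma> \<beta>"
proof -
  have "constant_on_parts (joined_partition n a b) (colouring3 \<alpha> \<gamma> \<beta>) \<longleftrightarrow>
      constant_on_parts a (colouring3 \<alpha> \<gamma> \<beta>) \<and> constant_on_parts (shift b) (colouring3 \<alpha> \<gamma> \<beta>)"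
    unfolding joined_partition_def
    using partitions_subset[OF assms(1)] shift_subset[OF assms(2)]
    by (subst constant_on_parts_generated_equiv) auto
  also have "constant_on_parts a (colouring3 \<alpha> \<gamma> \<beta>) \<longleftrightarrow> entry a \<alpha> \<gamma>"
    unfolding entry_def
    by (rule constant_on_parts_cong[OF partitions_subset[OF assms(1)]])
      (auto simp: colouring3_def colouring_def row_def)
  also have "constant_on_parts (shift b) (colouring3 \<alpha> \<gamma> \<beta>) \<longleftrightarrow> entry b \<gamma> \<beta>"
    unfolding entry_def shift_def constant_on_parts_relabel
    by (rule constant_on_parts_cong[OF partitions_subset[OF assms(2)]])
      (auto simp: colouring3_def colouring_def row_def)
  finally show ?thesis .
qed

text \<open>The word \<open>\<gamma>\<close> is free: the relation on the right involves outer rows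
  only, where \<open>colouring3\<close> does not consult it.\<close>

lemma entry_partition_comp:
  "entry (partition_comp n a b) \<alpha> \<beta> \<longleftrightarrow>
     constant_on_parts (joined_partition n a b \<inter> (row n 0 \<union> row n 2) \<times> (row n 0 \<union> row n 2))
       (colouring3 \<alpha> \<gamma> \<beta>)"
  unfolding entry_def partition_comp_def constant_on_parts_relabel
  by (rule constant_on_parts_cong[of _ "row n 0 \<union> row n 2"])
    (auto simp: colouring3_def colouring_def row_def)

lemma partition_comp_in_partitions:
  assumes "a \<in> partitions n" "b \<in> partitions n"
  shows "partition_comp n a b \<in> partitions n"
proof -
  let ?g = "\<lambda>(i, l). (i, if l = 2 then 1 else l) :: vertex"
  let ?U = "row n 0 \<union> row n 2"
  have "equiv ?U (joined_partition n a b \<inter> ?U \<times> ?U)"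
    by (rule equiv_restrict[OF joined_partition_equiv[OF assms]]) auto
  then have "equiv (?g ` ?U) (partition_comp n a b)"
    unfolding partition_comp_def
    by (rule equiv_relabel) (auto simp: inj_on_def row_def split: if_splits)
  moreover have "?g ` ?U = row n 0 \<union> row n 1"
    by (force simp: row_def image_iff)
  ultimately show ?thesis by (simp add: partitions_def)
qed

lemma partition_comp_mono:
  "a1 \<subseteq> a2 \<Longrightarrow> b1 \<subseteq> b2 \<Longrightarrow> partition_comp n a1 b1 \<subseteq> partition_comp n a2 b2"
proof -
  assume "a1 \<subseteq> a2" "b1 \<subseteq> b2"
  then have "joined_partition n a1 b1 \<subseteq> joined_partition n a2 b2"
    unfolding joined_partition_def shift_def relabel_def
    by (intro generated_equiv_mono Un_mono image_mono)
  then show ?thesis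
    unfolding partition_comp_def relabel_def by (intro image_mono) auto
qed

text \<open>A colouring of the outer rows that is constant on the parts of the composite extends to the
  middle row by choosing a colour freely on each part inside the middle row.\<close>

lemma card_middle_words:
  assumes a: "a \<in> partitions n" and b: "b \<in> partitions n"
    and \<alpha>: "\<alpha> \<in> words n N" and \<beta>: "\<beta> \<in> words n N"
  shows "card {\<gamma> \<in> words n N. entry a \<alpha> \<gamma> \<and> entry b \<gamma> \<beta>} =
    (if entry (partition_comp n a b) \<alpha> \<beta> then N ^ middle_parts n a b else 0)"
proof (cases "entry (partition_comp n a b) \<alpha> \<beta>")
  case False
  let ?U = "row n 0 \<union> row n 2"
  have "\<not> (entry a \<alpha> \<gamma> \<and> entry b \<gamma> \<beta>)" for \<gamma>
  proof
    assume "entry a \<alpha> \<gamma> \<and> entry b \<gamma> \<beta>"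
    then have "constant_on_parts (joined_partition n a b) (colouring3 \<alpha> \<gamma> \<beta>)"
      using constant_on_parts_joined_partition[OF a b] by blast
    then have "constant_on_parts (joined_partition n a b \<inter> ?U \<times> ?U) (colouring3 \<alpha> \<gamma> \<beta>)"
      by (rule constant_on_parts_mono[rotated]) auto
    with False show False using entry_partition_comp by blast
  qed
  with False show ?thesis by simp
next
  case True
  define J where "J = joined_partition n a b"
  define V where "V = row n 0 \<union> row n 1 \<union> row n 2"
  let ?U = "row n 0 \<union> row n 2"
  let ?M = "{P \<in> V // J. P \<subseteq> row n 1}"
  let ?G = "{\<gamma> \<in> words n N. entry a \<alpha> \<gamma> \<and> entry b \<gamma> \<beta>}"
  have J: "equiv V J" unfolding J_def V_def by (rule joined_partition_equiv[OF a b])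
  have G: "\<gamma> \<in> ?G \<longleftrightarrow> \<gamma> \<in> words n N \<and> constant_on_parts J (colouring3 \<alpha> \<gamma> \<beta>)" for \<gamma>
    using constant_on_parts_joined_partition[OF a b] by (simp add: J_def)
  have outer: "constant_on_parts (J \<inter> ?U \<times> ?U) (colouring3 \<alpha> \<gamma> \<beta>)" for \<gamma>
    using True entry_partition_comp unfolding J_def by blast
  have col_lt: "colouring3 \<alpha> \<gamma> \<beta> x < N" if "x \<in> V" "\<gamma> \<in> words n N" for \<gamma> x
    using that \<alpha> \<beta> by (auto simp: V_def colouring3_def row_def words_def dest: PiE_mem)
  have col_lt': "colouring3 \<alpha> \<gamma> \<beta> x < N" if "x \<in> ?U" for \<gamma> x
    using that \<alpha> \<beta> by (auto simp: V_def colouring3_def row_def words_def dest: PiE_mem)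
  have finM: "finite ?M"
    using finite_quotient[of V J] J by (auto simp: V_def elim!: equivE)
  \<comment> \<open>The bijection records a middle word by its colours on the parts inside the
    middle row; \<open>extend\<close> below is its inverse.\<close>
  define colours where "colours = (\<lambda>\<gamma>. \<lambda>P\<in>?M. colouring3 \<alpha> \<gamma> \<beta> (SOME x. x \<in> P))"
  \<comment> \<open>A part that meets an outer row has its colour forced by \<open>\<alpha>\<close>
    or \<open>\<beta>\<close>. It is read off at an outer vertex, so \<open>undefined\<close> can
    stand in for the middle word.\<close>
  define col where "col = (\<lambda>g P. if P \<in> ?M then g P else colouring3 \<alpha> undefined \<beta> (SOME x. x \<in> P \<inter> ?U))"
  have col_in: "col g P = g P" if "P \<in> ?M" for g P
    unfolding col_def using that by (rule if_P)
  have col_out: "col g P = colouring3 \<alpha> undefined \<beta> (SOME x. x \<in> P \<inter> ?U)" if "P \<notin> ?M" for g P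
    unfolding col_def using that by (rule if_not_P)
  define extend where "extend = (\<lambda>g. \<lambda>i\<in>{1..n}. (col g (J `` {(i, 1)}) :: nat))"
  have cls: "J `` {x} \<in> V // J" "x \<in> J `` {x}" if "x \<in> V" for x
    using that by (rule quotientI, rule equiv_class_self[OF J])
  \<comment> \<open>On the middle row this is the assumption on \<open>\<gamma>\<close>; on the
    outer rows it holds because compatibility with the composite makes the outer colours constant on
    each class.\<close>
  have col_eq: "colouring3 \<alpha> \<gamma> \<beta> x = col g (J `` {x})"
    if x: "x \<in> V" and g: "\<And>i. i \<in> {1..n} \<Longrightarrow> \<gamma> i = col g (J `` {(i, 1)})" for \<gamma> g x
  proof (cases "x \<in> row n 1")
    case True
    then show ?thesis using g by (auto simp: row_def colouring3_def)
  next
    case False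
    then have xU: "x \<in> ?U" using x by (auto simp: V_def)
    have nM: "J `` {x} \<notin> ?M" using cls(2)[OF x] False by auto
    have "(SOME y. y \<in> J `` {x} \<inter> ?U) \<in> J `` {x} \<inter> ?U"
      by (rule someI[of _ x]) (use cls(2)[OF x] xU in auto)
    then have "(x, SOME y. y \<in> J `` {x} \<inter> ?U) \<in> J \<inter> ?U \<times> ?U"
      using xU by blast
    from constant_on_partsD[OF outer[of undefined] this]
    have "colouring3 \<alpha> undefined \<beta> (SOME y. y \<in> J `` {x} \<inter> ?U) = colouring3 \<alpha> undefined \<beta> x" ..
    moreover have "colouring3 \<alpha> undefined \<beta> x = colouring3 \<alpha> \<gamma> \<beta> x"
      using xU by (auto simp: row_def colouring3_def)
    ultimately show ?thesis unfolding col_out[OF nM] by simp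
  qed
  have "bij_betw colours ?G (?M \<rightarrow>\<^sub>E {..<N})"
  proof (rule bij_betw_byWitness[where f' = extend])
    show "\<forall>\<gamma>\<in>?G. extend (colours \<gamma>) = \<gamma>"
    proof
      fix \<gamma> assume "\<gamma> \<in> ?G"
      then have \<gamma>: "\<gamma> \<in> words n N" "constant_on_parts J (colouring3 \<alpha> \<gamma> \<beta>)" using G by blast+
      show "extend (colours \<gamma>) = \<gamma>"
      proof
        fix i
        show "extend (colours \<gamma>) i = \<gamma> i"
        proof (cases "i \<in> {1..n}")
          case False
          then show ?thesis using \<gamma>(1) by (auto simp: extend_def words_def PiE_def extensional_def)
        next
          case True
          then have x: "(i, 1) \<in> V" by (auto simp: V_def row_def)
          let ?P = "J `` {(i, 1)}"
          have eq: "colouring3 \<alpha> \<gamma> \<beta> y = \<gamma> i" if "y \<in> ?P" for y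
            using constant_on_partsD[OF \<gamma>(2), of "(i, 1)" y] that by (auto simp: colouring3_def)
          show ?thesis
          proof (cases "?P \<in> ?M")
            case M: True
            have "(SOME x. x \<in> ?P) \<in> ?P" by (rule someI[of _ "(i, 1)"]) (rule cls(2)[OF x])
            then show ?thesis using True eq M by (simp only: extend_def restrict_apply' col_in[OF M] colours_def)
          next
            case M: False
            then have "\<not> ?P \<subseteq> row n 1" using cls[OF x] by auto
            moreover have "?P \<subseteq> V" using J unfolding equiv_def by blast
            ultimately obtain y where "y \<in> ?P \<inter> ?U" unfolding V_def by blast
            then have s: "(SOME y. y \<in> ?P \<inter> ?U) \<in> ?P \<inter> ?U" by (rule someI)
            then have "colouring3 \<alpha> undefined \<beta> (SOME y. y \<in> ?P \<inter> ?U) =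
                colouring3 \<alpha> \<gamma> \<beta> (SOME y. y \<in> ?P \<inter> ?U)"
              by (auto simp: row_def colouring3_def split: prod.splits)
            then show ?thesis using s eq by (simp only: extend_def restrict_apply'[OF True] col_out[OF M] Int_iff)
          qed
        qed
      qed
    qed
    show "\<forall>g\<in>?M \<rightarrow>\<^sub>E {..<N}. colours (extend g) = g"
    proof
      fix g assume g: "g \<in> ?M \<rightarrow>\<^sub>E {..<N}"
      show "colours (extend g) = g"
      proof
        fix P show "colours (extend g) P = g P"
        proof (cases "P \<in> ?M")
          case False
          then show ?thesis using g by (auto simp: colours_def PiE_def extensional_def)
        next
          case True
          then obtain z where z: "z \<in> V" "P = J `` {z}" by (auto elim!: quotientE)
          have s: "(SOME x. x \<in> P) \<in> P" by (rule someI[of _ z]) (use z cls in auto)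
          then have sV: "(SOME x. x \<in> P) \<in> V" using True by (auto simp: V_def)
          have "J `` {SOME x. x \<in> P} = P"
            using s z J by (metis Image_singleton_iff equiv_class_eq)
          moreover have "colouring3 \<alpha> (extend g) \<beta> (SOME x. x \<in> P) = col g (J `` {SOME x. x \<in> P})"
            by (rule col_eq[OF sV]) (simp add: extend_def)
          ultimately show ?thesis by (simp only: colours_def restrict_apply'[OF True] col_in[OF True])
        qed
      qed
    qed
    show "colours ` ?G \<subseteq> ?M \<rightarrow>\<^sub>E {..<N}"
    proof (rule image_subsetI)
      fix \<gamma> assume "\<gamma> \<in> ?G"
      then have \<gamma>: "\<gamma> \<in> words n N" by simp
      have "(SOME x. x \<in> P) \<in> V" if P: "P \<in> ?M" for P
      proof -
        obtain z where z: "z \<in> V" "P = J `` {z}" using P by (auto elim!: quotientE)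
        have "(SOME x. x \<in> P) \<in> P" by (rule someI[of _ z]) (use z cls in auto)
        then show ?thesis using P by (auto simp: V_def)
      qed
      then show "colours \<gamma> \<in> ?M \<rightarrow>\<^sub>E {..<N}"
        unfolding colours_def using col_lt[OF _ \<gamma>] by auto
    qed
    show "extend ` (?M \<rightarrow>\<^sub>E {..<N}) \<subseteq> ?G"
    proof (rule image_subsetI)
      fix g assume g: "g \<in> ?M \<rightarrow>\<^sub>E {..<N}"
      have lt: "col g (J `` {x}) < N" if x: "x \<in> V" for x
      proof (cases "J `` {x} \<in> ?M")
        case True
        then have "g (J `` {x}) \<in> {..<N}" using g by (meson PiE_mem)
        then show ?thesis unfolding col_in[OF True] by simp
      next
        case False
        then have "\<not> J `` {x} \<subseteq> row n 1" using cls[OF x] by auto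
        moreover have "J `` {x} \<subseteq> V" using J unfolding equiv_def by blast
        ultimately obtain y where "y \<in> J `` {x} \<inter> ?U" unfolding V_def by blast
        then have "(SOME y. y \<in> J `` {x} \<inter> ?U) \<in> J `` {x} \<inter> ?U" by (rule someI)
        then have "colouring3 \<alpha> undefined \<beta> (SOME y. y \<in> J `` {x} \<inter> ?U) < N"
          by (intro col_lt') auto
        then show ?thesis unfolding col_out[OF False] .
      qed
      have "extend g \<in> words n N"
        unfolding words_def extend_def by (auto intro!: lt simp: V_def row_def)
      moreover have "constant_on_parts J (colouring3 \<alpha> (extend g) \<beta>)"
        unfolding constant_on_parts_def
      proof (clarify)
        fix i l j m assume J': "((i, l), (j, m)) \<in> J"
        have "J \<subseteq> V \<times> V" using J by (rule equivE)
        then have V: "(i, l) \<in> V" "(j, m) \<in> V" using J' by blast+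
        have "J `` {(i, l)} = J `` {(j, m)}" using J' J by (metis equiv_class_eq)
        moreover have "colouring3 \<alpha> (extend g) \<beta> x = col g (J `` {x})" if "x \<in> V" for x
          by (rule col_eq[OF that]) (simp add: extend_def)
        ultimately show "colouring3 \<alpha> (extend g) \<beta> (i, l) = colouring3 \<alpha> (extend g) \<beta> (j, m)"
          using V by metis
      qed
      ultimately show "extend g \<in> ?G" using G by blast
    qed
  qed
  then have "card ?G = card (?M \<rightarrow>\<^sub>E {..<N})" by (rule bij_betw_same_card)
  also have "\<dots> = N ^ card ?M" by (subst card_PiE[OF finM]) simp
  also have "card ?M = middle_parts n a b" unfolding middle_parts_def J_def V_def ..
  finally show ?thesis using True by simp
qed

section \<open>Reflection of diagrams and separation of partitions by colourings\<close>

definition flip :: "vertex rel \<Rightarrow> vertex rel" where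
  "flip a = relabel (\<lambda>(i, l). (i, 1 - l)) a"

lemma image_involution:
  "(\<And>x. x \<in> V \<Longrightarrow> g x \<in> V) \<Longrightarrow> (\<And>x. x \<in> V \<Longrightarrow> g (g x) = x) \<Longrightarrow> g ` V = V"
  by (metis image_subsetI image_eqI subset_antisym subsetI)

lemma flip_in_partitions:
  assumes "a \<in> partitions n"
  shows "flip a \<in> partitions n"
proof -
  let ?g = "\<lambda>(i, l). (i, 1 - l) :: vertex"
  have "equiv (?g ` (row n 0 \<union> row n 1)) (flip a)"
    unfolding flip_def using assms
    by (intro equiv_relabel) (auto simp: partitions_def inj_on_def row_def)
  moreover have "?g ` (row n 0 \<union> row n 1) = row n 0 \<union> row n 1"
    by (rule image_involution) (auto simp: row_def)
  ultimately show ?thesis by (simp add: partitions_def)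
qed

lemma flip_mono: "a \<subseteq> b \<Longrightarrow> flip a \<subseteq> flip b"
  unfolding flip_def relabel_def by (rule image_mono)

text \<open>Reflection exchanges the two rows of vertices and so the two words. This is the source
  of the transposes in the positivity argument.\<close>

lemma entry_flip:
  assumes "a \<in> partitions n"
  shows "entry (flip a) \<alpha> \<beta> \<longleftrightarrow> entry a \<beta> \<alpha>"
  unfolding entry_def flip_def constant_on_parts_relabel
  by (rule constant_on_parts_cong[OF partitions_subset[OF assms]]) (auto simp: colouring_def row_def)

text \<open>Give distinct parts of \<open>d\<close> distinct colours; there are at most
  \<open>2 * n\<close> parts because there are \<open>2 * n\<close> vertices. The partitions with
  entry 1 at this position are then those below \<open>d\<close>, which makes the family of matrices
  triangular with respect to inclusion.\<close>

lemma partition_is_kernel: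
  assumes d: "d \<in> partitions n" and N: "2 * n \<le> N"
  obtains \<alpha> \<beta> where "\<alpha> \<in> words n N" "\<beta> \<in> words n N"
    "\<forall>b\<in>partitions n. entry b \<alpha> \<beta> \<longleftrightarrow> b \<subseteq> d"
proof -
  define V where "V = row n 0 \<union> row n 1"
  have e: "equiv V d" using d by (simp add: partitions_def V_def)
  have Vd: "V // d = (\<lambda>x. d `` {x}) ` V" by (auto simp: quotient_def)
  have "card (V // d) \<le> card V" "finite (V // d)"
    unfolding Vd by (rule card_image_le, simp add: V_def, simp add: V_def)
  moreover have "card V \<le> 2 * n"
    unfolding V_def by (rule order_trans[OF card_Un_le]) (simp add: row_def card_cartesian_product)
  ultimately obtain c where c: "c ` (V // d) \<subseteq> {..<N}" "inj_on c (V // d)"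
    using N card_le_inj[of "V // d" "{..<N}"] by auto
  define \<alpha> where "\<alpha> = (\<lambda>i\<in>{1..n}. c (d `` {(i, 0)}))"
  define \<beta> where "\<beta> = (\<lambda>i\<in>{1..n}. c (d `` {(i, 1)}))"
  have col: "colouring \<alpha> \<beta> x = c (d `` {x})" if "x \<in> V" for x
    using that by (auto simp: colouring_def \<alpha>_def \<beta>_def V_def row_def)
  have lt: "c (d `` {x}) < N" if "x \<in> V" for x
    using c(1) quotientI[OF that, of d] by blast
  show thesis
  proof
    show "\<alpha> \<in> words n N" "\<beta> \<in> words n N"
      unfolding words_def \<alpha>_def \<beta>_def by (auto intro!: lt simp: V_def row_def)
    show "\<forall>b\<in>partitions n. entry b \<alpha> \<beta> \<longleftrightarrow> b \<subseteq> d"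
    proof
      fix b assume "b \<in> partitions n"
      then have b: "b \<subseteq> V \<times> V" using partitions_subset unfolding V_def by blast
      have kernel: "colouring \<alpha> \<beta> x = colouring \<alpha> \<beta> y \<longleftrightarrow> (x, y) \<in> d" if xy: "(x, y) \<in> b" for x y
      proof -
        have V: "x \<in> V" "y \<in> V" using xy b by auto
        have "colouring \<alpha> \<beta> x = colouring \<alpha> \<beta> y \<longleftrightarrow> d `` {x} = d `` {y}"
          using V by (simp add: col inj_on_eq_iff[OF c(2)] quotientI)
        also have "\<dots> \<longleftrightarrow> (x, y) \<in> d"
          using V e by (simp add: eq_equiv_class_iff)
        finally show ?thesis .
      qed
      show "entry b \<alpha> \<beta> \<longleftrightarrow> b \<subseteq> d"
      proof
        assume "entry b \<alpha> \<beta>"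
        then show "b \<subseteq> d"
          unfolding entry_def by (intro subrelI) (blast intro: kernel[THEN iffD1] constant_on_partsD)
      next
        assume "b \<subseteq> d"
        then show "entry b \<alpha> \<beta>"
          unfolding entry_def constant_on_parts_def using kernel by blast
      qed
    qed
  qed
qed

lemma partition_eqI:
  assumes "a \<in> partitions n" "b \<in> partitions n" and N: "2 * n \<le> N"
    and "\<And>\<alpha> \<beta>. \<alpha> \<in> words n N \<Longrightarrow> \<beta> \<in> words n N \<Longrightarrow> entry a \<alpha> \<beta> \<longleftrightarrow> entry b \<alpha> \<beta>"
  shows "a = b"
proof
  show "a \<subseteq> b"
    by (rule partition_is_kernel[OF assms(2) N]) (use assms in blast)
  show "b \<subseteq> a"
    by (rule partition_is_kernel[OF assms(1) N]) (use assms in blast)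
qed

text \<open>Stated over any commutative semiring, since the algebra laws use it over the naturals
  and the positivity argument over the reals.\<close>

lemma sum_entry_entry:
  fixes N :: nat
  assumes "a \<in> partitions n" "b \<in> partitions n" "\<alpha> \<in> words n N" "\<beta> \<in> words n N"
  shows "(\<Sum>\<gamma>\<in>words n N. of_bool (entry a \<alpha> \<gamma>) * of_bool (entry b \<gamma> \<beta>)) =
    (of_nat N ^ middle_parts n a b * of_bool (entry (partition_comp n a b) \<alpha> \<beta>) :: 'r::comm_semiring_1)"
proof -
  have "(\<Sum>\<gamma>\<in>words n N. of_bool (entry a \<alpha> \<gamma>) * of_bool (entry b \<gamma> \<beta>)) =
      (\<Sum>\<gamma>\<in>words n N. of_bool (entry a \<alpha> \<gamma> \<and> entry b \<gamma> \<beta>) :: 'r)"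
    by (intro sum.cong) auto
  also have "\<dots> = of_nat (card {\<gamma> \<in> words n N. entry a \<alpha> \<gamma> \<and> entry b \<gamma> \<beta>})"
    by (subst sum_of_bool_eq) (simp_all only: finite_words Int_def mem_Collect_eq)
  finally show ?thesis
    by (simp add: card_middle_words[OF assms])
qed

section \<open>Associativity and unit laws read off from matrices\<close>

lemma const_word: "0 < N \<Longrightarrow> (\<lambda>i\<in>{1..n}. 0) \<in> words n N"
  by (auto simp: words_def)

lemma entry_const:
  assumes "a \<in> partitions n"
  shows "entry a (\<lambda>i\<in>{1..n}. 0) (\<lambda>i\<in>{1..n}. 0)"
proof -
  have "constant_on_parts a (\<lambda>_. 0 :: nat)" by (simp add: constant_on_parts_def)
  then show ?thesis
    unfolding entry_def
    by (subst constant_on_parts_cong[OF partitions_subset[OF assms]])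
      (auto simp: colouring_def row_def)
qed

text \<open>Weights and partitions can both be read off from the matrices for a large number of colours,
  the weights from a constant colouring; hence the algebra laws follow from those of matrices.\<close>

lemma weighted_entry_eqD:
  assumes a: "a \<in> partitions n" and b: "b \<in> partitions n"
    and eq: "\<And>N \<alpha> \<beta>. \<alpha> \<in> words n N \<Longrightarrow> \<beta> \<in> words n N \<Longrightarrow>
      N ^ c * of_bool (entry a \<alpha> \<beta>) = (N ^ d * of_bool (entry b \<alpha> \<beta>) :: nat)"
  shows "a = b" "c = d"
proof -
  \<comment> \<open>At least \<open>2 * n\<close> colours separate partitions, and at least 2 are
    needed for \<open>N ^ c\<close> to determine \<open>c\<close>; the sum covers both, also for
    \<open>n = 0\<close>.\<close>
  define N where "N = 2 * n + 2"
  have z: "(\<lambda>i\<in>{1..n}. 0) \<in> words n N" by (rule const_word) (simp add: N_def)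
  have "N ^ c = N ^ d"
    using eq[OF z z] entry_const[OF a] entry_const[OF b] by simp
  then show cd: "c = d" by (simp add: N_def)
  show "a = b"
  proof (rule partition_eqI[OF a b])
    show "2 * n \<le> N" by (simp add: N_def)
    fix \<alpha> \<beta> assume "\<alpha> \<in> words n N" "\<beta> \<in> words n N"
    from eq[OF this] cd show "entry a \<alpha> \<beta> \<longleftrightarrow> entry b \<alpha> \<beta>"
      by (cases "entry a \<alpha> \<beta>"; cases "entry b \<alpha> \<beta>") (auto simp: N_def)
  qed
qed

lemma partition_comp_assoc:
  assumes a: "a \<in> partitions n" and b: "b \<in> partitions n" and d: "d \<in> partitions n"
  shows "partition_comp n (partition_comp n a b) d = partition_comp n a (partition_comp n b d)"
    and "middle_parts n a b + middle_parts n (partition_comp n a b) d =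
      middle_parts n b d + middle_parts n a (partition_comp n b d)"
proof -
  note ab = partition_comp_in_partitions[OF a b]
  note bd = partition_comp_in_partitions[OF b d]
  have "N ^ (middle_parts n a b + middle_parts n (partition_comp n a b) d) *
        of_bool (entry (partition_comp n (partition_comp n a b) d) \<alpha> \<beta>) =
      (N ^ (middle_parts n b d + middle_parts n a (partition_comp n b d)) *
        of_bool (entry (partition_comp n a (partition_comp n b d)) \<alpha> \<beta>) :: nat)"
    if w: "\<alpha> \<in> words n N" "\<beta> \<in> words n N" for N \<alpha> \<beta>
  proof -
    have "N ^ (middle_parts n a b + middle_parts n (partition_comp n a b) d) *
        of_bool (entry (partition_comp n (partition_comp n a b) d) \<alpha> \<beta>) =
      N ^ middle_parts n a b *
        (\<Sum>\<delta>\<in>words n N. of_bool (entry (partition_comp n a b) \<alpha> \<delta>) * of_bool (entry d \<delta> \<beta>))"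
      by (simp only: sum_entry_entry[OF ab d w] power_add mult.assoc of_nat_id)
    also have "\<dots> = (\<Sum>\<delta>\<in>words n N. (\<Sum>\<gamma>\<in>words n N. of_bool (entry a \<alpha> \<gamma>) * of_bool (entry b \<gamma> \<delta>)) *
        of_bool (entry d \<delta> \<beta>))"
      unfolding sum_distrib_left[of "N ^ middle_parts n a b"]
      by (intro sum.cong refl, subst sum_entry_entry[OF a b w(1)]) (auto simp only: mult.assoc of_nat_id)
    \<comment> \<open>Exchanging the sums over the two intermediate words is associativity of the
      matrix product.\<close>
    also have "\<dots> = (\<Sum>\<gamma>\<in>words n N. of_bool (entry a \<alpha> \<gamma>) *
        (\<Sum>\<delta>\<in>words n N. of_bool (entry b \<gamma> \<delta>) * of_bool (entry d \<delta> \<beta>)))"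
      unfolding sum_distrib_left sum_distrib_right mult.assoc by (rule sum.swap)
    also have "\<dots> = N ^ middle_parts n b d *
        (\<Sum>\<gamma>\<in>words n N. of_bool (entry a \<alpha> \<gamma>) * of_bool (entry (partition_comp n b d) \<gamma> \<beta>))"
      unfolding sum_distrib_left[of "N ^ middle_parts n b d"]
      by (intro sum.cong refl, subst sum_entry_entry[OF b d _ w(2)]) (auto simp only: mult_ac of_nat_id)
    also have "\<dots> = N ^ (middle_parts n b d + middle_parts n a (partition_comp n b d)) *
        of_bool (entry (partition_comp n a (partition_comp n b d)) \<alpha> \<beta>)"
      by (simp only: sum_entry_entry[OF a bd w] power_add mult.assoc of_nat_id)
    finally show ?thesis .
  qed
  note eqD = weighted_entry_eqD[OF partition_comp_in_partitions[OF ab d] partition_comp_in_partitions[OF a bd] this]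
  show "partition_comp n (partition_comp n a b) d = partition_comp n a (partition_comp n b d)"
    by (rule eqD(1))
  show "middle_parts n a b + middle_parts n (partition_comp n a b) d =
      middle_parts n b d + middle_parts n a (partition_comp n b d)"
    by (rule eqD(2))
qed

lemma identity_partition_in_partitions: "identity_partition n \<in> partitions n"
  unfolding partitions_def identity_partition_def using equiv_kernel[of _ fst] by blast

lemma entry_identity_partition:
  assumes "\<alpha> \<in> words n N" "\<beta> \<in> words n N"
  shows "entry (identity_partition n) \<alpha> \<beta> \<longleftrightarrow> \<alpha> = \<beta>"
proof
  assume e: "entry (identity_partition n) \<alpha> \<beta>"
  have "\<alpha> i = \<beta> i" if "i \<in> {1..n}" for i
    using constant_on_partsD[OF e[unfolded entry_def], of "(i, 0)" "(i, 1)"] that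
    by (auto simp: identity_partition_def row_def colouring_def)
  then show "\<alpha> = \<beta>"
    using assms unfolding words_def by (intro PiE_ext) auto
qed (auto simp: entry_def constant_on_parts_def identity_partition_def colouring_def)

lemma partition_comp_identity:
  assumes b: "b \<in> partitions n"
  shows "partition_comp n (identity_partition n) b = b" "middle_parts n (identity_partition n) b = 0"
    "partition_comp n b (identity_partition n) = b" "middle_parts n b (identity_partition n) = 0"
proof -
  note i = identity_partition_in_partitions[of n]
  have l: "N ^ middle_parts n (identity_partition n) b *
      of_bool (entry (partition_comp n (identity_partition n) b) \<alpha> \<beta>) = (N ^ 0 * of_bool (entry b \<alpha> \<beta>) :: nat)"
    if w: "\<alpha> \<in> words n N" "\<beta> \<in> words n N" for N \<alpha> \<beta>
  proof -
    have "(\<Sum>\<gamma>\<in>words n N. of_bool (entry (identity_partition n) \<alpha> \<gamma>) * of_bool (entry b \<gamma> \<beta>)) =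
        (\<Sum>\<gamma>\<in>words n N. if \<alpha> = \<gamma> then of_bool (entry b \<gamma> \<beta>) else 0 :: nat)"
      using w by (intro sum.cong refl) (simp add: entry_identity_partition)
    then show ?thesis using w sum_entry_entry[OF i b w, where 'r=nat] by (simp add: sum.delta)
  qed
  note eqD = weighted_entry_eqD[OF partition_comp_in_partitions[OF i b] b l]
  show "partition_comp n (identity_partition n) b = b" by (rule eqD(1))
  show "middle_parts n (identity_partition n) b = 0" by (rule eqD(2))
  have r: "N ^ middle_parts n b (identity_partition n) *
      of_bool (entry (partition_comp n b (identity_partition n)) \<alpha> \<beta>) = (N ^ 0 * of_bool (entry b \<alpha> \<beta>) :: nat)"
    if w: "\<alpha> \<in> words n N" "\<beta> \<in> words n N" for N \<alpha> \<beta>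
  proof -
    have "(\<Sum>\<gamma>\<in>words n N. of_bool (entry b \<alpha> \<gamma>) * of_bool (entry (identity_partition n) \<gamma> \<beta>)) =
        (\<Sum>\<gamma>\<in>words n N. if \<gamma> = \<beta> then of_bool (entry b \<alpha> \<gamma>) else 0 :: nat)"
      using w by (intro sum.cong refl) (simp add: entry_identity_partition)
    then show ?thesis using w sum_entry_entry[OF b i w, where 'r=nat] by (simp add: sum.delta)
  qed
  note eqD' = weighted_entry_eqD[OF partition_comp_in_partitions[OF b i] b r]
  show "partition_comp n b (identity_partition n) = b" by (rule eqD'(1))
  show "middle_parts n b (identity_partition n) = 0" by (rule eqD'(2))
qed

section \<open>Left ideals generated by idempotents\<close>

context ring begin

text \<open>Additive inverses are left multiples by the negative of the unit, so they need no
  closure condition of their own.\<close>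

lemma left_idealI:
  assumes "I \<subseteq> carrier R" "\<zero> \<in> I"
    and add: "\<And>x y. x \<in> I \<Longrightarrow> y \<in> I \<Longrightarrow> x \<oplus> y \<in> I"
    and mult: "\<And>r x. r \<in> carrier R \<Longrightarrow> x \<in> I \<Longrightarrow> r \<otimes> x \<in> I"
  shows "left_ideal I R"
proof -
  have "\<ominus> x \<in> I" if "x \<in> I" for x
  proof -
    have "\<ominus> x = (\<ominus> \<one>) \<otimes> x"
      using that assms(1) by (simp add: l_minus subsetD)
    then show ?thesis using mult[OF a_inv_closed[OF one_closed] that] by simp
  qed
  then have "subgroup I (add_monoid R)"
    using assms by (intro subgroup.intro) (auto simp: a_inv_def)
  then show ?thesis
    using mult by (auto simp: left_ideal_def additive_subgroup_def)
qed

lemma left_idealD: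
  assumes "left_ideal I R"
  shows "I \<subseteq> carrier R" "\<zero> \<in> I"
    "\<And>x y. x \<in> I \<Longrightarrow> y \<in> I \<Longrightarrow> x \<oplus> y \<in> I"
    "\<And>r x. r \<in> carrier R \<Longrightarrow> x \<in> I \<Longrightarrow> r \<otimes> x \<in> I"
    "\<And>x y. x \<in> I \<Longrightarrow> y \<in> I \<Longrightarrow> x \<ominus> y \<in> I"
proof -
  interpret I: additive_subgroup I R using assms by (simp add: left_ideal_def)
  show "I \<subseteq> carrier R" by (rule I.a_subset)
  show "\<zero> \<in> I" by simp
  show "x \<oplus> y \<in> I" if "x \<in> I" "y \<in> I" for x y using that by simp
  show "r \<otimes> x \<in> I" if "r \<in> carrier R" "x \<in> I" for r x
    using assms that by (simp add: left_ideal_def)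
  show "x \<ominus> y \<in> I" if "x \<in> I" "y \<in> I" for x y
    using that unfolding a_minus_def by (intro I.a_closed I.a_inv_closed)
qed

lemma left_ideal_finsum:
  assumes "left_ideal I R" "finite A" "\<And>a. a \<in> A \<Longrightarrow> f a \<in> I"
  shows "(\<Oplus>a\<in>A. f a) \<in> I"
  using assms(2,3)
proof (induction A rule: finite_induct)
  case (insert a A)
  note I = left_idealD[OF assms(1)]
  have "f \<in> A \<rightarrow> carrier R" "f a \<in> carrier R" using insert.prems I(1) by auto
  then have "(\<Oplus>a\<in>insert a A. f a) = f a \<oplus> (\<Oplus>a\<in>A. f a)"
    by (rule finsum_insert[OF insert.hyps])
  then show ?case using insert I(3) by simp
qed (simp add: left_idealD[OF assms(1)])

text \<open>Induction on the measure \<open>\<mu>\<close>, later the dimension. A nonzero left ideal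
  \<open>L\<close> of least measure inside \<open>I\<close> is simple, and its right unit splits it
  off from \<open>I\<close>, leaving a complement of smaller measure.\<close>

lemma left_ideal_decomposition:
  fixes \<mu> :: "'a set \<Rightarrow> nat"
  assumes idem: "\<And>I. left_ideal I R \<Longrightarrow> \<exists>e\<in>I. \<forall>x\<in>I. x \<otimes> e = x"
    and mono: "\<And>I J. left_ideal I R \<Longrightarrow> left_ideal J R \<Longrightarrow> I \<subset> J \<Longrightarrow> \<mu> I < \<mu> J"
    and "left_ideal I R"
  shows "\<exists>S. finite S \<and> (\<forall>K\<in>S. simple_left_ideal K R \<and> K \<subseteq> I) \<and>
    (\<forall>x\<in>I. \<exists>!g. g \<in> (\<Pi>\<^sub>E K\<in>S. K) \<and> x = (\<Oplus>K\<in>S. g K))"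
  using assms(3)
proof (induction "\<mu> I" arbitrary: I rule: less_induct)
  case less
  note I = left_idealD[OF less.prems]
  show ?case
  proof (cases "I = {\<zero>}")
    case True
    then show ?thesis by (intro exI[of _ "{}"]) auto
  next
    case False
    obtain L where L: "left_ideal L R \<and> L \<subseteq> I \<and> L \<noteq> {\<zero>}"
      and least: "\<And>J. left_ideal J R \<and> J \<subseteq> I \<and> J \<noteq> {\<zero>} \<Longrightarrow> \<mu> L \<le> \<mu> J"
      using ex_has_least_nat[of "\<lambda>J. left_ideal J R \<and> J \<subseteq> I \<and> J \<noteq> {\<zero>}" I \<mu>] less.prems False
      by blast
    have simple: "simple_left_ideal L R"
      unfolding simple_left_ideal_def
      using L least mono by (metis psubsetI subset_trans linorder_not_less)
    note LD = left_idealD[OF conjunct1[OF L]]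
    obtain e where e: "e \<in> L" "\<And>x. x \<in> L \<Longrightarrow> x \<otimes> e = x"
      using idem L by blast
    have ec: "e \<in> carrier R" using e LD by blast
    \<comment> \<open>The kernel of the projection \<open>x \<mapsto> x \<otimes> e\<close> of
      \<open>I\<close> onto \<open>L\<close>; the induction continues on this complement.\<close>
    define I' where "I' = {x \<in> I. x \<otimes> e = \<zero>}"
    have I': "left_ideal I' R"
    proof (rule left_idealI)
      show "I' \<subseteq> carrier R" unfolding I'_def using I(1) by blast
      show "\<zero> \<in> I'" unfolding I'_def using I(2) ec by simp
      show "x \<oplus> y \<in> I'" if "x \<in> I'" "y \<in> I'" for x y
      proof -
        have "x \<in> I" "y \<in> I" "x \<otimes> e = \<zero>" "y \<otimes> e = \<zero>" using that by (simp_all add: I'_def)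
        moreover have "x \<in> carrier R" "y \<in> carrier R" using calculation I(1) by blast+
        ultimately show ?thesis using I(3) ec by (simp add: I'_def l_distr)
      qed
      show "r \<otimes> x \<in> I'" if "r \<in> carrier R" "x \<in> I'" for r x
      proof -
        have "x \<in> I" "x \<otimes> e = \<zero>" using that by (simp_all add: I'_def)
        moreover have "x \<in> carrier R" using calculation I(1) by blast
        ultimately show ?thesis using I(4) that(1) ec by (simp add: I'_def m_assoc)
      qed
    qed
    \<comment> \<open>This serves twice: \<open>I'\<close> is strictly smaller than
      \<open>I\<close>, and \<open>L\<close> is not among the summands already found in
      \<open>I'\<close>, so inserting it really adds a summand.\<close>
    have nL: "\<not> L \<subseteq> I'"
    proof
      assume "L \<subseteq> I'"
      then have "x = \<zero>" if "x \<in> L" for x using that e(2)[OF that] unfolding I'_def by auto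
      then show False using L LD(2) by blast
    qed
    then have "I' \<subset> I" using L unfolding I'_def by auto
    from less.hyps[OF mono[OF I' less.prems this] I'] obtain S where
      S: "finite S" "\<forall>K\<in>S. simple_left_ideal K R \<and> K \<subseteq> I'"
      and ex1: "\<forall>x\<in>I'. \<exists>!g. g \<in> (\<Pi>\<^sub>E K\<in>S. K) \<and> x = (\<Oplus>K\<in>S. g K)"
      by (elim exE conjE)
    have LS: "L \<notin> S" using S nL by blast
    have I'I: "I' \<subseteq> I" unfolding I'_def by auto
    have fc: "h \<in> S \<rightarrow> carrier R" if "\<And>K. K \<in> S \<Longrightarrow> h K \<in> K" for h
      using that S(2) I(1) I'I by blast
    have "\<exists>!g. g \<in> (\<Pi>\<^sub>E K\<in>insert L S. K) \<and> x = (\<Oplus>K\<in>insert L S. g K)" if x: "x \<in> I" for x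
    proof -
      have xc: "x \<in> carrier R" using x I by blast
      have xe: "x \<otimes> e \<in> L" using LD(4)[OF xc e(1)] .
      have xec: "x \<otimes> e \<in> carrier R" using xc ec by simp
      define z where "z = x \<ominus> x \<otimes> e"
      have zI: "z \<in> I" unfolding z_def using x xe L by (intro I(5)) auto
      have "z \<otimes> e = x \<otimes> e \<ominus> (x \<otimes> e) \<otimes> e"
        unfolding z_def a_minus_def using xc ec by (simp add: l_distr l_minus)
      also have "\<dots> = \<zero>" using e(2)[OF xe] xec by (simp add: a_minus_def r_neg)
      finally have z: "z \<in> I'" unfolding I'_def using zI by simp
      have xz: "x = x \<otimes> e \<oplus> z"
        unfolding z_def a_minus_def using xc xec
        by (metis a_assoc a_comm a_inv_closed r_neg r_zero)
      obtain g where g: "g \<in> (\<Pi>\<^sub>E K\<in>S. K)" "z = (\<Oplus>K\<in>S. g K)"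
        and g_uniq: "\<And>h. h \<in> (\<Pi>\<^sub>E K\<in>S. K) \<Longrightarrow> z = (\<Oplus>K\<in>S. h K) \<Longrightarrow> h = g"
        using ex1[rule_format, OF z] by (elim ex1E) blast
      show ?thesis
      proof (intro ex1I conjI)
        let ?g = "g(L := x \<otimes> e)"
        show "?g \<in> (\<Pi>\<^sub>E K\<in>insert L S. K)"
          using PiE_fun_upd[OF xe g(1)] by simp
        have gS: "g \<in> S \<rightarrow> carrier R" using g(1) by (intro fc) auto
        have gz: "(\<Oplus>K\<in>S. ?g K) = z"
          unfolding g(2) using gS LS by (intro finsum_cong') auto
        have "?g \<in> S \<rightarrow> carrier R" using gS LS by auto
        moreover have "?g L \<in> carrier R" using xec by simp
        ultimately have "(\<Oplus>K\<in>insert L S. ?g K) = ?g L \<oplus> z"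
          unfolding gz[symmetric] by (rule finsum_insert[OF S(1) LS])
        then show "x = (\<Oplus>K\<in>insert L S. ?g K)" using xz by (simp only: fun_upd_same)
        \<comment> \<open>Uniqueness: multiplying a decomposition by \<open>e\<close> on the right
          kills its part in \<open>I'\<close> and fixes its part in \<open>L\<close>, so the latter
          must be \<open>x \<otimes> e\<close>; uniqueness inside \<open>I'\<close> settles the
          rest.\<close>
        fix h assume h: "h \<in> (\<Pi>\<^sub>E K\<in>insert L S. K) \<and> x = (\<Oplus>K\<in>insert L S. h K)"
        have hL: "h L \<in> L" and hK: "\<And>K. K \<in> S \<Longrightarrow> h K \<in> K" using h by auto
        define v where "v = (\<Oplus>K\<in>S. h K)"
        have v: "v \<in> I'" unfolding v_def
          using hK S(2) by (intro left_ideal_finsum[OF I' S(1)]) blast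
        have c: "h L \<in> carrier R" "v \<in> carrier R" using hL v LD(1) I'I I(1) by auto
        have xv: "x = h L \<oplus> v"
          using h finsum_insert[OF S(1) LS fc[OF hK] c(1)] unfolding v_def by simp
        then have xe': "x \<otimes> e = h L"
          using c ec e(2)[OF hL] v by (simp add: l_distr I'_def)
        have "z = v"
          using xz xv c xec zI I(1) xe' by (metis add.l_cancel subsetD)
        moreover have "(\<Oplus>K\<in>S. restrict h S K) = v"
          unfolding v_def by (rule finsum_cong'[OF refl fc[OF hK]]) simp_all
        moreover have "restrict h S \<in> (\<Pi>\<^sub>E K\<in>S. K)" using hK by simp
        ultimately have gh: "restrict h S = g" by (intro g_uniq) simp_all
        show "h = ?g"
        proof
          fix K
          have "h K = undefined" if "K \<noteq> L" "K \<notin> S"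
            using h that by (auto intro: PiE_arb)
          then show "h K = ?g K"
            using xe' by (auto simp: gh[symmetric])
        qed
      qed
    qed
    moreover have "simple_left_ideal K R \<and> K \<subseteq> I" if "K \<in> insert L S" for K
      using that S(2) L I'I simple by blast
    ultimately show ?thesis
      using S(1) by (intro exI[of _ "insert L S"] conjI ballI) simp_all
  qed
qed

lemma semisimple_ringI:
  fixes \<mu> :: "'a set \<Rightarrow> nat"
  assumes "\<And>I. left_ideal I R \<Longrightarrow> \<exists>e\<in>I. \<forall>x\<in>I. x \<otimes> e = x"
    and "\<And>I J. left_ideal I R \<Longrightarrow> left_ideal J R \<Longrightarrow> I \<subset> J \<Longrightarrow> \<mu> I < \<mu> J"
  shows "semisimple_ring R"
proof -
  have c: "left_ideal (carrier R) R" by (rule left_idealI) auto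
  have "\<exists>S. finite S \<and> (\<forall>K\<in>S. simple_left_ideal K R \<and> K \<subseteq> carrier R) \<and>
    (\<forall>x\<in>carrier R. \<exists>!g. g \<in> (\<Pi>\<^sub>E K\<in>S. K) \<and> x = (\<Oplus>K\<in>S. g K))"
    by (rule left_ideal_decomposition[where \<mu> = \<mu>]) (assumption | rule assms c)+
  then obtain S where
    "finite S" "\<forall>K\<in>S. simple_left_ideal K R \<and> K \<subseteq> carrier R"
    "\<forall>x\<in>carrier R. \<exists>!g. g \<in> (\<Pi>\<^sub>E K\<in>S. K) \<and> x = (\<Oplus>K\<in>S. g K)"
    by (elim exE conjE)
  then show ?thesis
    unfolding semisimple_ring_def using ring_axioms by (intro conjI exI[of _ S]) simp_all
qed

end

section \<open>Matrices over finite index sets\<close>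

text \<open>Matrices are plain functions and only the summation set is named. Outer indices remain
  unrestricted, so associativity is an unconditional equation between functions and can be used for
  rewriting.\<close>

definition matmul :: "'b set \<Rightarrow> ('a \<Rightarrow> 'b \<Rightarrow> 'k::semiring_0) \<Rightarrow> ('b \<Rightarrow> 'c \<Rightarrow> 'k) \<Rightarrow> 'a \<Rightarrow> 'c \<Rightarrow> 'k" where
  "matmul B U W a c = (\<Sum>b\<in>B. U a b * W b c)"

lemma matmul_assoc: "matmul B (matmul A U W) Z = matmul A U (matmul B W Z)"
proof (intro ext)
  fix a c
  show "matmul B (matmul A U W) Z a c = matmul A U (matmul B W Z) a c"
    unfolding matmul_def sum_distrib_left sum_distrib_right mult.assoc by (rule sum.swap)
qed

lemma matmul_cong_left: "(\<And>b. b \<in> B \<Longrightarrow> U a b = U' a b) \<Longrightarrow> matmul B U W a c = matmul B U' W a c"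
  by (simp add: matmul_def)

lemma matmul_cong_right: "(\<And>b. b \<in> B \<Longrightarrow> W b c = W' b c) \<Longrightarrow> matmul B U W a c = matmul B U W' a c"
  by (simp add: matmul_def)

lemma matmul_id_left:
  fixes W :: "'b \<Rightarrow> 'c \<Rightarrow> 'k::semiring_1"
  assumes "finite B" "a \<in> B" "\<And>b. b \<in> B \<Longrightarrow> U a b = of_bool (a = b)"
  shows "matmul B U W a c = W a c"
proof -
  have "matmul B U W a c = (\<Sum>b\<in>B. if a = b then W b c else 0)"
    unfolding matmul_def using assms(3) by (intro sum.cong) auto
  then show ?thesis using assms by (simp add: sum.delta)
qed

lemma matmul_id_right:
  fixes U :: "'a \<Rightarrow> 'b \<Rightarrow> 'k::semiring_1"
  assumes "finite B" "c \<in> B" "\<And>b. b \<in> B \<Longrightarrow> W b c = of_bool (b = c)"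
  shows "matmul B U W a c = U a c"
proof -
  have "matmul B U W a c = (\<Sum>b\<in>B. if b = c then U a b else 0)"
    unfolding matmul_def using assms(3) by (intro sum.cong) auto
  then show ?thesis using assms by (simp add: sum.delta)
qed

text \<open>Write \<open>t\<close> for the transpose of \<open>s\<close>. Transposing
  \<open>F s = 1\<close> gives \<open>t F = 1\<close>, as \<open>F\<close> is symmetric; hence
  \<open>t = t F s = s\<close>, and \<open>s\<close> is also a left inverse.\<close>

lemma symmetric_inverse:
  fixes F s :: "'b \<Rightarrow> 'b \<Rightarrow> 'k::comm_ring_1"
  assumes "finite B" and sym: "\<And>a c. a \<in> B \<Longrightarrow> c \<in> B \<Longrightarrow> F a c = F c a"
    and inv: "\<And>a c. a \<in> B \<Longrightarrow> c \<in> B \<Longrightarrow> matmul B F s a c = of_bool (a = c)"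
    and "a \<in> B" "c \<in> B"
  shows "s a c = s c a" "matmul B s F a c = of_bool (a = c)"
proof -
  have s_sym: "s a c = s c a" if ac: "a \<in> B" "c \<in> B" for a c
  proof -
    have "s a c = matmul B (\<lambda>x y. of_bool (x = y)) s a c"
      by (rule matmul_id_left[OF assms(1) ac(1), symmetric]) simp
    also have "\<dots> = matmul B (matmul B (\<lambda>x y. s y x) F) s a c"
    proof (rule matmul_cong_left)
      fix b assume b: "b \<in> B"
      then have "of_bool (a = b) = matmul B F s b a"
        using ac by (simp add: inv eq_commute)
      also have "\<dots> = matmul B (\<lambda>x y. s y x) F a b"
        unfolding matmul_def using b by (intro sum.cong refl) (simp add: sym[of b] mult.commute)
      finally show "of_bool (a = b) = matmul B (\<lambda>x y. s y x) F a b" .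
    qed
    also have "\<dots> = matmul B (\<lambda>x y. s y x) (matmul B F s) a c"
      by (simp only: matmul_assoc)
    also have "\<dots> = s c a"
      using ac by (intro matmul_id_right assms(1)) (simp_all add: inv)
    finally show ?thesis .
  qed
  then show "s a c = s c a" using assms by blast
  have "matmul B s F a c = matmul B F s c a"
    unfolding matmul_def using assms(4,5)
    by (intro sum.cong refl) (simp add: sym[of c] s_sym[of a] mult.commute)
  then show "matmul B s F a c = of_bool (a = c)" using assms(4,5) by (simp add: inv eq_commute)
qed

section \<open>Projections and dimensions in spaces of functions\<close>

interpretation function_space: vector_space "\<lambda>c (f :: 'b \<Rightarrow> 'k::field) d. c * f d"
  by standard (auto simp: fun_eq_iff algebra_simps)

lemma sum_fun_apply: "(\<Sum>a\<in>A. f a) d = (\<Sum>a\<in>A. f a d)"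
  for f :: "'a \<Rightarrow> 'b \<Rightarrow> 'k::comm_monoid_add"
  by (induction A rule: infinite_finite_induct) (auto simp: zero_fun_def)

text \<open>The identity map has a linear left inverse on the subspace \<open>I\<close>. Linearity
  is recorded as compatibility with finite combinations, the form in which the averaging argument
  applies it.\<close>

lemma exists_projection:
  fixes I :: "('b \<Rightarrow> 'k::field) set"
  assumes "function_space.subspace I" and "finite A"
  shows "\<exists>\<pi> :: ('b \<Rightarrow> 'k) \<Rightarrow> 'b \<Rightarrow> 'k. (\<forall>f. \<pi> f \<in> I) \<and> (\<forall>f\<in>I. \<pi> f = f) \<and>
    (\<forall>(x :: 'c \<Rightarrow> 'k) f. \<pi> (\<lambda>d. \<Sum>t\<in>A. x t * f t d) = (\<lambda>d. \<Sum>t\<in>A. x t * \<pi> (f t) d))"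
proof -
  let ?s = "\<lambda>c (f :: 'b \<Rightarrow> 'k) d. c * f d"
  interpret vector_space_pair ?s ?s by unfold_locales
  have "Vector_Spaces.linear ?s ?s (\<lambda>x. x)"
    using function_space.linear_ident .
  from linear_exists_left_inverse_on[OF this assms(1)] obtain \<pi> where
    \<pi>: "\<pi> ` UNIV \<subseteq> I" "Vector_Spaces.linear ?s ?s \<pi>" "\<forall>v\<in>I. \<pi> v = v"
    by auto
  interpret \<pi>: Vector_Spaces.linear ?s ?s \<pi> by fact
  show ?thesis
  proof (intro exI[of _ \<pi>] conjI allI ballI)
    show "\<pi> f \<in> I" for f using \<pi> by auto
    show "\<pi> f = f" if "f \<in> I" for f using \<pi> that by auto
    fix x :: "'c \<Rightarrow> 'k" and f
    have "\<pi> (\<lambda>d. \<Sum>t\<in>A. x t * f t d) = \<pi> (\<Sum>t\<in>A. ?s (x t) (f t))"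
      by (intro arg_cong[of _ _ \<pi>]) (auto simp: sum_fun_apply)
    also have "\<dots> = (\<lambda>d. \<Sum>t\<in>A. x t * \<pi> (f t) d)"
      by (auto simp: \<pi>.sum \<pi>.scale sum_fun_apply)
    finally show "\<pi> (\<lambda>d. \<Sum>t\<in>A. x t * f t d) = (\<lambda>d. \<Sum>t\<in>A. x t * \<pi> (f t) d)" .
  qed
qed

definition basis :: "'b \<Rightarrow> 'b \<Rightarrow> 'k::zero_neq_one" where
  "basis a d = (if d = a then 1 else 0)"

lemma basis_expansion:
  fixes f :: "'b \<Rightarrow> 'k::semiring_1"
  assumes "finite B" "\<And>d. d \<notin> B \<Longrightarrow> f d = 0"
  shows "f d = (\<Sum>t\<in>B. f t * basis t d)"
proof -
  have "(\<Sum>t\<in>B. f t * basis t d) = (\<Sum>t\<in>B. if t = d then f t else 0)"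
    by (intro sum.cong) (auto simp: basis_def)
  then show ?thesis using assms by (simp add: sum.delta)
qed

text \<open>The space of all functions may have infinite dimension, so finiteness has to come from
  the support in \<open>B\<close>. A vector of \<open>J\<close> outside \<open>I\<close> then
  enlarges a basis of \<open>I\<close> to a larger independent set in \<open>J\<close>.\<close>

lemma dim_strict_mono:
  fixes I J :: "('b \<Rightarrow> 'k::field) set"
  assumes "finite B" and J: "\<And>f d. f \<in> J \<Longrightarrow> d \<notin> B \<Longrightarrow> f d = 0"
    and I: "function_space.subspace I" and "function_space.subspace J" and IJ: "I \<subset> J"
  shows "function_space.dim I < function_space.dim J"
proof -
  have sp: "J \<subseteq> function_space.span (basis ` B)"
  proof
    fix f assume "f \<in> J"
    then have "f = (\<Sum>t\<in>B. (\<lambda>d. f t * basis t d))"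
      unfolding fun_eq_iff sum_fun_apply using J by (intro allI basis_expansion[OF assms(1)])
    also have "\<dots> \<in> function_space.span (basis ` B)"
      by (intro function_space.span_sum function_space.span_scale function_space.span_base) auto
    finally show "f \<in> function_space.span (basis ` B)" .
  qed
  obtain C where C: "C \<subseteq> I" "function_space.independent C" "I \<subseteq> function_space.span C"
    "card C = function_space.dim I" by (rule function_space.basis_exists)
  obtain D where D: "D \<subseteq> J" "function_space.independent D" "J \<subseteq> function_space.span D"
    "card D = function_space.dim J" by (rule function_space.basis_exists)
  have finD: "finite D"
    using function_space.independent_span_bound[OF finite_imageI[OF assms(1)] D(2)] D(1) sp by blast
  obtain v where v: "v \<in> J" "v \<notin> I" using IJ by blast
  have "function_space.span C \<subseteq> I" using C(1) I by (rule function_space.span_minimal)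
  then have vC: "v \<notin> function_space.span C" using v by blast
  then have ind: "function_space.independent (insert v C)"
    using C(2) by (rule function_space.independent_insertI)
  have "insert v C \<subseteq> function_space.span D" using v C IJ D by blast
  from function_space.independent_span_bound[OF finD ind this]
  have "finite (insert v C)" "card (insert v C) \<le> card D" by auto
  moreover have "v \<notin> C" using vC function_space.span_base by blast
  ultimately show ?thesis using C D by simp
qed

section \<open>Algebras with a multiplicative basis\<close>

text \<open>The product of a twisted monoid algebra, with \<open>w\<close> in the role of a
  2-cocycle; the sum is arranged as in \<open>ramified_mult\<close>, which is an instance.\<close>

definition twisted_mult ::
  "'b set \<Rightarrow> ('b \<Rightarrow> 'b \<Rightarrow> 'b) \<Rightarrow> ('b \<Rightarrow> 'b \<Rightarrow> 'k::comm_ring_1) \<Rightarrow> ('b \<Rightarrow> 'k) \<Rightarrow> ('b \<Rightarrow> 'k) \<Rightarrow> 'b \<Rightarrow> 'k" where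
  "twisted_mult B cmp w f g = (\<lambda>d. \<Sum>a\<in>B. \<Sum>b\<in>B. if d = cmp a b then f a * g b * w a b else 0)"

definition twisted_algebra ::
  "'b set \<Rightarrow> ('b \<Rightarrow> 'b \<Rightarrow> 'b) \<Rightarrow> ('b \<Rightarrow> 'b \<Rightarrow> 'k::comm_ring_1) \<Rightarrow> 'b \<Rightarrow> ('k, 'b \<Rightarrow> 'k) module" where
  "twisted_algebra B cmp w e =
     \<lparr>carrier = {f. \<forall>d. d \<notin> B \<longrightarrow> f d = 0},
      monoid.mult = twisted_mult B cmp w,
      one = basis e,
      ring.zero = (\<lambda>d. 0),
      add = (\<lambda>f g d. f d + g d),
      module.smult = (\<lambda>c f d. c * f d)\<rparr>"

text \<open>In \<open>left_matrix cmp w a d c\<close> the row index is \<open>d\<close>. The trace form is that of the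
  regular representation.\<close>

definition left_matrix :: "('b \<Rightarrow> 'b \<Rightarrow> 'b) \<Rightarrow> ('b \<Rightarrow> 'b \<Rightarrow> 'k::comm_ring_1) \<Rightarrow> 'b \<Rightarrow> 'b \<Rightarrow> 'b \<Rightarrow> 'k" where
  "left_matrix cmp w a d c = (if cmp a c = d then w a c else 0)"

definition trace_form :: "'b set \<Rightarrow> ('b \<Rightarrow> 'b \<Rightarrow> 'b) \<Rightarrow> ('b \<Rightarrow> 'b \<Rightarrow> 'k::comm_ring_1) \<Rightarrow> 'b \<Rightarrow> 'b \<Rightarrow> 'k" where
  "trace_form B cmp w a b = (\<Sum>d\<in>B. \<Sum>c\<in>B. left_matrix cmp w a d c * left_matrix cmp w b c d)"

lemma trace_form_sym: "trace_form B cmp w a b = trace_form B cmp w b a"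
  unfolding trace_form_def by (subst sum.swap) (simp add: mult.commute)

text \<open>\<open>w_assoc\<close> is the 2-cocycle identity and \<open>w_left\<close>,
  \<open>w_right\<close> are its normalisation. The field is left open because both the reals and
  \<open>k\<close> occur.\<close>

locale twisted_monoid =
  fixes B :: "'b set" and cmp :: "'b \<Rightarrow> 'b \<Rightarrow> 'b" (infixl \<open>\<star>\<close> 70)
    and w :: "'b \<Rightarrow> 'b \<Rightarrow> 'k::field" and e :: 'b
  assumes finite_B: "finite B"
    and closed: "\<And>a b. a \<in> B \<Longrightarrow> b \<in> B \<Longrightarrow> a \<star> b \<in> B"
    and assoc: "\<And>a b c. a \<in> B \<Longrightarrow> b \<in> B \<Longrightarrow> c \<in> B \<Longrightarrow> a \<star> b \<star> c = a \<star> (b \<star> c)"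
    and w_assoc: "\<And>a b c. a \<in> B \<Longrightarrow> b \<in> B \<Longrightarrow> c \<in> B \<Longrightarrow>
      w a b * w (a \<star> b) c = w b c * w a (b \<star> c)"
    and e_in: "e \<in> B"
    and e_left: "\<And>a. a \<in> B \<Longrightarrow> e \<star> a = a" and e_right: "\<And>a. a \<in> B \<Longrightarrow> a \<star> e = a"
    and w_left: "\<And>a. a \<in> B \<Longrightarrow> w e a = 1" and w_right: "\<And>a. a \<in> B \<Longrightarrow> w a e = 1"
begin

abbreviation mult :: "('b \<Rightarrow> 'k) \<Rightarrow> ('b \<Rightarrow> 'k) \<Rightarrow> 'b \<Rightarrow> 'k" where
  "mult \<equiv> twisted_mult B (\<star>) w"

abbreviation alg :: "('k, 'b \<Rightarrow> 'k) module" where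
  "alg \<equiv> twisted_algebra B (\<star>) w e"

abbreviation T :: "'b \<Rightarrow> 'b \<Rightarrow> 'k" where
  "T \<equiv> trace_form B (\<star>) w"

text \<open>Eliminates the summation over the values of a product. With it both bracketings in
  \<open>mult_assoc\<close> become sums over triples of basis elements, to which the cocycle
  identity applies termwise.\<close>

lemma sum_mult:
  "(\<Sum>d\<in>B. mult f g d * h d) = (\<Sum>a\<in>B. \<Sum>b\<in>B. f a * g b * w a b * h (a \<star> b))"
proof -
  have "(\<Sum>d\<in>B. mult f g d * h d) =
      (\<Sum>d\<in>B. \<Sum>a\<in>B. \<Sum>b\<in>B. if d = a \<star> b then f a * g b * w a b * h d else 0)"
    unfolding twisted_mult_def sum_distrib_right by (intro sum.cong refl) auto
  also have "\<dots> = (\<Sum>a\<in>B. \<Sum>d\<in>B. \<Sum>b\<in>B. if d = a \<star> b then f a * g b * w a b * h d else 0)"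
    by (rule sum.swap)
  also have "\<dots> = (\<Sum>a\<in>B. \<Sum>b\<in>B. \<Sum>d\<in>B. if d = a \<star> b then f a * g b * w a b * h d else 0)"
    by (rule sum.cong[OF refl], rule sum.swap)
  also have "\<dots> = (\<Sum>a\<in>B. \<Sum>b\<in>B. f a * g b * w a b * h (a \<star> b))"
    by (intro sum.cong refl) (simp add: sum.delta finite_B closed)
  finally show ?thesis .
qed

lemma mult_assoc: "mult (mult f g) h = mult f (mult g h)"
proof
  fix d
  have "mult (mult f g) h d =
      (\<Sum>p\<in>B. mult f g p * (\<Sum>c\<in>B. if d = p \<star> c then h c * w p c else 0))"
    unfolding twisted_mult_def[of B cmp w "mult f g"] sum_distrib_left
    by (intro sum.cong refl) auto
  also have "\<dots> = (\<Sum>a\<in>B. \<Sum>b\<in>B. f a * g b * w a b * (\<Sum>c\<in>B. if d = a \<star> b \<star> c then h c * w (a \<star> b) c else 0))"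
    by (rule sum_mult)
  also have "\<dots> = (\<Sum>a\<in>B. f a * (\<Sum>b\<in>B. \<Sum>c\<in>B. g b * h c * w b c * (if d = a \<star> (b \<star> c) then w a (b \<star> c) else 0)))"
  proof (unfold sum_distrib_left, intro sum.cong refl)
    fix a b c assume abc: "a \<in> B" "b \<in> B" "c \<in> B"
    have "f a * g b * w a b * (h c * w (a \<star> b) c) = f a * (g b * h c * (w a b * w (a \<star> b) c))"
      by (simp only: mult_ac)
    then show "f a * g b * w a b * (if d = a \<star> b \<star> c then h c * w (a \<star> b) c else 0) =
        f a * (g b * h c * w b c * (if d = a \<star> (b \<star> c) then w a (b \<star> c) else 0))"
      using abc by (simp add: assoc w_assoc mult.assoc)
  qed
  also have "\<dots> = (\<Sum>a\<in>B. f a * (\<Sum>p\<in>B. mult g h p * (if d = a \<star> p then w a p else 0)))"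
    by (simp only: sum_mult)
  also have "\<dots> = mult f (mult g h) d"
    unfolding twisted_mult_def[of B cmp w f] sum_distrib_left
    by (intro sum.cong refl) auto
  finally show "mult (mult f g) h d = mult f (mult g h) d" .
qed

lemma mult_outside: "d \<notin> B \<Longrightarrow> mult f g d = 0"
  unfolding twisted_mult_def using closed by (intro sum.neutral ballI) auto

lemma mult_add_left: "mult (\<lambda>d. f d + g d) h d = mult f h d + mult g h d"
  unfolding twisted_mult_def sum.distrib[symmetric]
  by (intro sum.cong refl) (simp add: algebra_simps)

lemma mult_add_right: "mult h (\<lambda>d. f d + g d) d = mult h f d + mult h g d"
  unfolding twisted_mult_def sum.distrib[symmetric]
  by (intro sum.cong refl) (simp add: algebra_simps)

lemma mult_scale_left: "mult (\<lambda>d. c * f d) h d = c * mult f h d"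
  unfolding twisted_mult_def sum_distrib_left
  by (intro sum.cong refl) simp

lemma mult_scale_right: "mult h (\<lambda>d. c * f d) d = c * mult h f d"
  unfolding twisted_mult_def sum_distrib_left
  by (intro sum.cong refl) simp

lemma mult_sum_left: "mult (\<lambda>d. \<Sum>t\<in>A. f t d) h d = (\<Sum>t\<in>A. mult (f t) h d)"
proof (induction A rule: infinite_finite_induct)
  case (insert t A)
  then show ?case by (simp add: mult_add_left)
qed (simp_all add: twisted_mult_def cong: if_cong)

lemma mult_sum_right: "mult h (\<lambda>d. \<Sum>t\<in>A. f t d) d = (\<Sum>t\<in>A. mult h (f t) d)"
proof (induction A rule: infinite_finite_induct)
  case (insert t A)
  then show ?case by (simp add: mult_add_right)
qed (simp_all add: twisted_mult_def cong: if_cong)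

lemma mult_basis_left:
  assumes "a \<in> B"
  shows "mult (basis a) g d = (\<Sum>b\<in>B. if d = a \<star> b then g b * w a b else 0)"
proof -
  have "mult (basis a) g d = (\<Sum>c\<in>B. if c = a then (\<Sum>b\<in>B. if d = a \<star> b then g b * w a b else 0) else 0)"
    unfolding twisted_mult_def by (intro sum.cong refl) (auto simp: basis_def intro!: sum.neutral sum.cong)
  then show ?thesis using assms by (simp add: sum.delta finite_B)
qed

lemma mult_basis_right:
  assumes "b \<in> B"
  shows "mult f (basis b) d = (\<Sum>a\<in>B. if d = a \<star> b then f a * w a b else 0)"
  unfolding twisted_mult_def
proof (intro sum.cong refl)
  fix a
  have "(\<Sum>c\<in>B. if d = a \<star> c then f a * basis b c * w a c else 0) =
      (\<Sum>c\<in>B. if c = b then (if d = a \<star> b then f a * w a b else 0) else 0)"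
    by (intro sum.cong refl) (auto simp: basis_def)
  then show "(\<Sum>c\<in>B. if d = a \<star> c then f a * basis b c * w a c else 0) =
      (if d = a \<star> b then f a * w a b else 0)"
    using assms by (simp add: sum.delta finite_B)
qed

lemma mult_basis:
  assumes "a \<in> B" "b \<in> B"
  shows "mult (basis a) (basis b) = (\<lambda>d. w a b * basis (a \<star> b) d)"
proof
  fix d
  have "mult (basis a) (basis b) d = (\<Sum>c\<in>B. if c = b then (if d = a \<star> b then w a b else 0) else 0)"
    unfolding mult_basis_left[OF assms(1)] by (intro sum.cong refl) (auto simp: basis_def)
  then show "mult (basis a) (basis b) d = w a b * basis (a \<star> b) d"
    using assms by (simp add: sum.delta finite_B basis_def)
qed

lemma mult_unit_left:
  assumes "\<And>d. d \<notin> B \<Longrightarrow> f d = 0"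
  shows "mult (basis e) f = f"
proof
  fix d
  have "mult (basis e) f d = (\<Sum>b\<in>B. if b = d then f b else 0)"
    unfolding mult_basis_left[OF e_in] by (intro sum.cong refl) (auto simp: e_left w_left)
  then show "mult (basis e) f d = f d"
    using assms by (simp add: sum.delta finite_B)
qed

lemma mult_unit_right:
  assumes "\<And>d. d \<notin> B \<Longrightarrow> f d = 0"
  shows "mult f (basis e) = f"
proof
  fix d
  have "mult f (basis e) d = (\<Sum>b\<in>B. if b = d then f b else 0)"
    unfolding mult_basis_right[OF e_in] by (intro sum.cong refl) (auto simp: e_right w_right)
  then show "mult f (basis e) d = f d"
    using assms by (simp add: sum.delta finite_B)
qed

section \<open>Ring, module and algebra laws\<close>

lemma alg_simps:
  "carrier alg = {f. \<forall>d. d \<notin> B \<longrightarrow> f d = 0}" "f \<otimes>\<^bsub>alg\<^esub> g = mult f g" "\<one>\<^bsub>alg\<^esub> = basis e"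
  "\<zero>\<^bsub>alg\<^esub> = (\<lambda>d. 0)" "f \<oplus>\<^bsub>alg\<^esub> g = (\<lambda>d. f d + g d)" "c \<odot>\<^bsub>alg\<^esub> f = (\<lambda>d. c * f d)"
  by (simp_all add: twisted_algebra_def)

lemma abelian_group_alg: "abelian_group alg"
proof (rule abelian_groupI)
  fix f assume "f \<in> carrier alg"
  then show "\<exists>g\<in>carrier alg. g \<oplus>\<^bsub>alg\<^esub> f = \<zero>\<^bsub>alg\<^esub>"
    by (intro bexI[of _ "\<lambda>d. - f d"]) (simp_all add: alg_simps)
qed (auto simp: alg_simps fun_eq_iff)

lemma ring_alg: "ring alg"
proof (rule ringI[OF abelian_group_alg])
  show "monoid alg"
    by (rule monoidI)
      (auto simp: alg_simps mult_assoc mult_outside mult_unit_left mult_unit_right e_in basis_def)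
qed (simp_all add: alg_simps fun_eq_iff mult_add_left mult_add_right)

lemma assoc_unital_algebra_alg: "assoc_unital_algebra (ring_of_type_algebra :: 'k ring) alg"
proof -
  have K: "x \<oplus>\<^bsub>ring_of_type_algebra\<^esub> y = x + y" "x \<otimes>\<^bsub>ring_of_type_algebra\<^esub> y = x * y"
    "\<one>\<^bsub>ring_of_type_algebra\<^esub> = (1 :: 'k)" for x y :: 'k
    by (simp_all add: ring_of_type_algebra_def)
  have "module (ring_of_type_algebra :: 'k ring) alg"
  proof (rule moduleI)
    show "cring (ring_of_type_algebra :: 'k ring)" by (rule cring_from_type_algebra)
    show "abelian_group alg" by (rule abelian_group_alg)
    fix a b :: 'k and f g :: "'b \<Rightarrow> 'k"
    assume fg: "f \<in> carrier alg" "g \<in> carrier alg"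
    show "a \<odot>\<^bsub>alg\<^esub> f \<in> carrier alg"
      using fg(1) by (simp add: alg_simps)
    show "(a \<oplus>\<^bsub>ring_of_type_algebra\<^esub> b) \<odot>\<^bsub>alg\<^esub> f = a \<odot>\<^bsub>alg\<^esub> f \<oplus>\<^bsub>alg\<^esub> b \<odot>\<^bsub>alg\<^esub> f"
      unfolding K alg_simps by (simp only: distrib_right)
    show "a \<odot>\<^bsub>alg\<^esub> (f \<oplus>\<^bsub>alg\<^esub> g) = a \<odot>\<^bsub>alg\<^esub> f \<oplus>\<^bsub>alg\<^esub> a \<odot>\<^bsub>alg\<^esub> g"
      unfolding K alg_simps by (simp only: distrib_left)
    show "(a \<otimes>\<^bsub>ring_of_type_algebra\<^esub> b) \<odot>\<^bsub>alg\<^esub> f = a \<odot>\<^bsub>alg\<^esub> (b \<odot>\<^bsub>alg\<^esub> f)"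
      unfolding K alg_simps by (simp only: mult.assoc)
    show "\<one>\<^bsub>ring_of_type_algebra\<^esub> \<odot>\<^bsub>alg\<^esub> f = f"
      unfolding K alg_simps by simp
  qed
  then show ?thesis
    unfolding assoc_unital_algebra_def using ring_alg
    by (simp add: alg_simps mult_scale_left[abs_def] mult_scale_right[abs_def] fun_eq_iff)
qed

text \<open>Each column of \<open>left_matrix\<close> has at most one nonzero entry, so only the
  \<open>d\<close> returned to themselves by \<open>b\<close> followed by \<open>a\<close>
  contribute to the trace.\<close>

lemma trace_form_eq:
  assumes "a \<in> B" "b \<in> B"
  shows "T a b = (\<Sum>d\<in>B. if a \<star> (b \<star> d) = d then w b d * w a (b \<star> d) else 0)"
  unfolding trace_form_def left_matrix_def
proof (intro sum.cong refl)
  fix d assume d: "d \<in> B"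
  have "(\<Sum>c\<in>B. (if a \<star> c = d then w a c else 0) * (if b \<star> d = c then w b d else 0)) =
      (\<Sum>c\<in>B. if b \<star> d = c then (if a \<star> c = d then w b d * w a c else 0) else 0)"
    by (intro sum.cong refl) auto
  then show "(\<Sum>c\<in>B. (if a \<star> c = d then w a c else 0) * (if b \<star> d = c then w b d else 0)) =
      (if a \<star> (b \<star> d) = d then w b d * w a (b \<star> d) else 0)"
    using assms d by (simp add: sum.delta finite_B closed)
qed

text \<open>Both sides are the trace of left multiplication by \<open>a\<close>, then
  \<open>t\<close>, then \<open>b\<close>; the factors in front are the weights of the products of
  \<open>t\<close> with \<open>a\<close> and of \<open>b\<close> with \<open>t\<close>.\<close>

lemma trace_form_invariant:
  assumes "a \<in> B" "b \<in> B" "t \<in> B"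
  shows "w t a * T b (t \<star> a) = w b t * T (b \<star> t) a"
  unfolding trace_form_eq[OF assms(2) closed[OF assms(3,1)]] trace_form_eq[OF closed[OF assms(2,3)] assms(1)]
    sum_distrib_left
proof (intro sum.cong refl)
  fix d assume d: "d \<in> B"
  have "w t a * (w (t \<star> a) d * w b (t \<star> a \<star> d)) = (w t a * w (t \<star> a) d) * w b (t \<star> a \<star> d)"
    by (simp only: mult_ac)
  also have "\<dots> = w a d * (w t (a \<star> d) * w b (t \<star> (a \<star> d)))"
    using assms d by (simp only: w_assoc assoc mult.assoc)
  also have "\<dots> = w a d * (w b t * w (b \<star> t) (a \<star> d))"
    using assms d by (simp only: w_assoc closed)
  finally show "w t a * (if b \<star> (t \<star> a \<star> d) = d then w (t \<star> a) d * w b (t \<star> a \<star> d) else 0) =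
      w b t * (if b \<star> t \<star> (a \<star> d) = d then w a d * w (b \<star> t) (a \<star> d) else 0)"
    using assms d by (simp add: assoc closed mult_ac)
qed

lemma trace_form_unit:
  assumes "t \<in> B"
  shows "T t e = (\<Sum>a\<in>B. if t \<star> a = a then w t a else 0)"
  unfolding trace_form_eq[OF assms e_in] by (intro sum.cong refl) (simp add: e_left w_left)

end

section \<open>The Casimir element of the regular trace form, and averaging over it\<close>

locale nondegenerate_twisted_monoid = twisted_monoid +
  fixes s :: "'a \<Rightarrow> 'a \<Rightarrow> 'b"
  assumes T_s: "\<And>a c. a \<in> B \<Longrightarrow> c \<in> B \<Longrightarrow> matmul B T s a c = of_bool (a = c)"
begin

lemma s_sym: "a \<in> B \<Longrightarrow> c \<in> B \<Longrightarrow> s a c = s c a"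
  and s_T: "a \<in> B \<Longrightarrow> c \<in> B \<Longrightarrow> matmul B s T a c = of_bool (a = c)"
  using symmetric_inverse[OF finite_B, of T s] T_s trace_form_sym by metis+

text \<open>The element \<open>\<Sum> s a b \<cdot> a \<otimes> b\<close> of the tensor square is a Casimir element:
  \<open>s\<close> intertwines left and right multiplication because the trace form is invariant.\<close>

lemma casimir:
  fixes G :: "'a \<Rightarrow> 'a \<Rightarrow> 'b"
  assumes t: "t \<in> B"
  shows "(\<Sum>a\<in>B. \<Sum>b\<in>B. s a b * w t a * G (t \<star> a) b) = (\<Sum>a\<in>B. \<Sum>b\<in>B. s a b * w b t * G a (b \<star> t))"
proof -
  \<comment> \<open>\<open>L\<close> is the matrix of left multiplication by \<open>t\<close>, and
    \<open>R\<close> the transposed matrix of right multiplication by \<open>t\<close>.\<close>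
  define L where "L = (\<lambda>c a. if t \<star> a = c then w t a else 0)"
  define R where "R = (\<lambda>b c. if b \<star> t = c then w b t else 0)"
  \<comment> \<open>Invariance of the form says \<open>T L = R T\<close>; multiplying by
    \<open>s\<close> on both sides yields \<open>L s = s R\<close>, which is the claim in matrix
    form.\<close>
  have TL: "matmul B T L b a = matmul B R T b a" if "a \<in> B" "b \<in> B" for a b
  proof -
    have "matmul B T L b a = (\<Sum>c\<in>B. if t \<star> a = c then w t a * T b c else 0)"
      unfolding matmul_def L_def by (intro sum.cong refl) simp
    also have "\<dots> = w b t * T (b \<star> t) a"
      using that t by (simp add: sum.delta finite_B closed trace_form_invariant)
    also have "\<dots> = (\<Sum>c\<in>B. if b \<star> t = c then w b t * T c a else 0)"
      using that t by (simp add: sum.delta finite_B closed)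
    also have "\<dots> = matmul B R T b a"
      unfolding matmul_def R_def by (intro sum.cong refl) simp
    finally show ?thesis .
  qed
  have Ls: "matmul B L s c b = matmul B s R c b" if "c \<in> B" "b \<in> B" for c b
  proof -
    have "matmul B L s c b = matmul B (matmul B s T) (matmul B L s) c b"
      using that by (intro matmul_id_left[symmetric] finite_B s_T)
    also have "\<dots> = matmul B s (matmul B (matmul B T L) s) c b"
      by (simp only: matmul_assoc)
    also have "\<dots> = matmul B s (matmul B (matmul B R T) s) c b"
      by (intro matmul_cong_right matmul_cong_left TL)
    also have "\<dots> = matmul B (matmul B s R) (matmul B T s) c b"
      by (simp only: matmul_assoc)
    also have "\<dots> = matmul B s R c b"
      using that by (intro matmul_id_right finite_B T_s)
    finally show ?thesis .
  qed
  have "(\<Sum>a\<in>B. \<Sum>b\<in>B. s a b * w t a * G (t \<star> a) b) =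
      (\<Sum>a\<in>B. \<Sum>b\<in>B. \<Sum>c\<in>B. L c a * s a b * G c b)"
  proof (intro sum.cong refl)
    fix a b assume "a \<in> B" "b \<in> B"
    have "(\<Sum>c\<in>B. L c a * s a b * G c b) = (\<Sum>c\<in>B. if t \<star> a = c then s a b * w t a * G c b else 0)"
      unfolding L_def by (intro sum.cong refl) (simp add: mult_ac)
    then show "s a b * w t a * G (t \<star> a) b = (\<Sum>c\<in>B. L c a * s a b * G c b)"
      using \<open>a \<in> B\<close> t by (simp add: sum.delta finite_B closed)
  qed
  also have "\<dots> = (\<Sum>a\<in>B. \<Sum>c\<in>B. \<Sum>b\<in>B. L c a * s a b * G c b)"
    by (rule sum.cong[OF refl], rule sum.swap)
  also have "\<dots> = (\<Sum>c\<in>B. \<Sum>a\<in>B. \<Sum>b\<in>B. L c a * s a b * G c b)"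
    by (rule sum.swap)
  also have "\<dots> = (\<Sum>c\<in>B. \<Sum>b\<in>B. \<Sum>a\<in>B. L c a * s a b * G c b)"
    by (rule sum.cong[OF refl], rule sum.swap)
  also have "\<dots> = (\<Sum>c\<in>B. \<Sum>b\<in>B. matmul B L s c b * G c b)"
    by (simp only: matmul_def sum_distrib_right)
  also have "\<dots> = (\<Sum>c\<in>B. \<Sum>b\<in>B. matmul B s R c b * G c b)"
    by (intro sum.cong refl) (simp only: Ls)
  also have "\<dots> = (\<Sum>c\<in>B. \<Sum>b\<in>B. \<Sum>a\<in>B. s c a * R a b * G c b)"
    by (simp only: matmul_def sum_distrib_right)
  also have "\<dots> = (\<Sum>c\<in>B. \<Sum>a\<in>B. \<Sum>b\<in>B. s c a * R a b * G c b)"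
    by (rule sum.cong[OF refl], rule sum.swap)
  also have "\<dots> = (\<Sum>c\<in>B. \<Sum>a\<in>B. s c a * w a t * G c (a \<star> t))"
  proof (intro sum.cong refl)
    fix c a assume "c \<in> B" "a \<in> B"
    have "(\<Sum>b\<in>B. s c a * R a b * G c b) = (\<Sum>b\<in>B. if a \<star> t = b then s c a * w a t * G c b else 0)"
      unfolding R_def by (intro sum.cong refl) simp
    then show "(\<Sum>b\<in>B. s c a * R a b * G c b) = s c a * w a t * G c (a \<star> t)"
      using \<open>a \<in> B\<close> t by (simp add: sum.delta finite_B closed)
  qed
  finally show ?thesis .
qed

text \<open>For an invariant form other than the trace form of the regular representation this product
  would only be central.\<close>

lemma casimir_product: "(\<Sum>a\<in>B. \<Sum>b\<in>B. s a b * w a b * basis (a \<star> b) d) = basis e d"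
proof -
  define z where "z = (\<lambda>d. \<Sum>a\<in>B. \<Sum>b\<in>B. s a b * w a b * (basis (a \<star> b) d :: 'b))"
  have inv: "f r = (\<Sum>t\<in>B. s r t * (\<Sum>c\<in>B. T t c * f c))" if "r \<in> B" for f r
  proof -
    have "f r = matmul B (matmul B s T) (\<lambda>c _. f c) r ()"
      using that by (intro matmul_id_left[symmetric] finite_B s_T)
    also have "\<dots> = matmul B s (matmul B T (\<lambda>c _. f c)) r ()"
      by (simp only: matmul_assoc)
    finally show ?thesis by (simp only: matmul_def)
  qed
  have basis_sum: "(\<Sum>c\<in>B. T t c * basis r c) = T t r" if "r \<in> B" for t r
  proof -
    have "(\<Sum>c\<in>B. T t c * basis r c) = (\<Sum>c\<in>B. if c = r then T t c else 0)"
      by (intro sum.cong refl) (simp add: basis_def)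
    then show ?thesis using that by (simp add: sum.delta finite_B)
  qed
  \<comment> \<open>As \<open>T\<close> is invertible, it is enough to compare \<open>z\<close> with
    the unit under the form. Invariance exposes the entries of \<open>T s = 1\<close> at
    \<open>(t \<star> a, a)\<close>, and what survives is the trace of left multiplication by
    \<open>t\<close>, that is \<open>T t e\<close>.\<close>
  have Tz: "(\<Sum>c\<in>B. T t c * z c) = T t e" if t: "t \<in> B" for t
  proof -
    have "(\<Sum>c\<in>B. T t c * z c) = (\<Sum>c\<in>B. \<Sum>a\<in>B. \<Sum>b\<in>B. s a b * w a b * (T t c * basis (a \<star> b) c))"
      unfolding z_def sum_distrib_left by (intro sum.cong refl) (simp only: mult_ac)
    also have "\<dots> = (\<Sum>a\<in>B. \<Sum>c\<in>B. \<Sum>b\<in>B. s a b * w a b * (T t c * basis (a \<star> b) c))"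
      by (rule sum.swap)
    also have "\<dots> = (\<Sum>a\<in>B. \<Sum>b\<in>B. \<Sum>c\<in>B. s a b * w a b * (T t c * basis (a \<star> b) c))"
      by (rule sum.cong[OF refl], rule sum.swap)
    also have "\<dots> = (\<Sum>a\<in>B. \<Sum>b\<in>B. s a b * (w a b * T t (a \<star> b)))"
      by (intro sum.cong refl) (simp add: sum_distrib_left[symmetric] basis_sum closed)
    also have "\<dots> = (\<Sum>a\<in>B. w t a * (\<Sum>b\<in>B. T (t \<star> a) b * s b a))"
      unfolding sum_distrib_left
    proof (intro sum.cong refl)
      fix a b assume ab: "a \<in> B" "b \<in> B"
      show "s a b * (w a b * T t (a \<star> b)) = w t a * (T (t \<star> a) b * s b a)"
        using trace_form_invariant[OF ab(2) t ab(1)] s_sym[OF ab] by (simp add: mult_ac)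
    qed
    also have "\<dots> = (\<Sum>a\<in>B. w t a * matmul B T s (t \<star> a) a)"
      by (simp only: matmul_def)
    also have "\<dots> = T t e"
      unfolding trace_form_unit[OF t] using t by (intro sum.cong refl) (simp add: T_s closed)
    finally show ?thesis .
  qed
  show ?thesis
  proof (cases "d \<in> B")
    case True
    have "z d = (\<Sum>t\<in>B. s d t * T t e)"
      unfolding inv[OF True, of z] by (intro sum.cong refl) (simp only: Tz)
    also have "\<dots> = basis e d"
      unfolding inv[OF True, of "basis e"] by (intro sum.cong refl) (simp only: basis_sum[OF e_in])
    finally show ?thesis unfolding z_def .
  next
    case False
    have "(\<Sum>a\<in>B. \<Sum>b\<in>B. s a b * w a b * (basis (a \<star> b) d :: 'b)) = 0"
      using False closed by (intro sum.neutral ballI) (auto simp: basis_def)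
    then show ?thesis using False e_in by (auto simp: basis_def)
  qed
qed

text \<open>A scalar acts as left multiplication by a multiple of the unit. Left ideals thereby
  acquire linear projections and dimensions.\<close>

lemma left_ideal_subspace:
  assumes "left_ideal I alg"
  shows "function_space.subspace I"
proof -
  note I = ring.left_idealD[OF ring_alg assms]
  show ?thesis
  proof (rule function_space.subspaceI)
    show "0 \<in> I" using I(2) by (simp add: alg_simps zero_fun_def)
    show "f + g \<in> I" if "f \<in> I" "g \<in> I" for f g
      using I(3)[OF that] by (simp add: alg_simps plus_fun_def)
    show "(\<lambda>d. c * f d) \<in> I" if f: "f \<in> I" for c f
    proof -
      have fc: "d \<notin> B \<Longrightarrow> f d = 0" for d using I(1) f by (auto simp: alg_simps)
      have "mult (\<lambda>d. c * basis e d) f = (\<lambda>d. c * f d)"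
        by (simp add: fun_eq_iff mult_scale_left mult_unit_left[OF fc])
      moreover have "(\<lambda>d. c * basis e d) \<in> carrier alg"
        using e_in by (auto simp: alg_simps basis_def)
      ultimately show ?thesis using I(4)[OF _ f] by (metis alg_simps(2))
    qed
  qed
qed

text \<open>Averaging a linear projection onto a left ideal over the Casimir element makes it
  right multiplication by an element of the ideal.\<close>

lemma left_ideal_right_unit:
  assumes L: "left_ideal I alg"
  shows "\<exists>u\<in>I. \<forall>x\<in>I. x \<otimes>\<^bsub>alg\<^esub> u = x"
proof -
  note I = ring.left_idealD[OF ring_alg L]
  have sub: "function_space.subspace I" by (rule left_ideal_subspace[OF L])
  obtain \<pi> :: "('a \<Rightarrow> 'b) \<Rightarrow> 'a \<Rightarrow> 'b" where \<pi>_in: "\<forall>f. \<pi> f \<in> I" and \<pi>_id: "\<forall>f\<in>I. \<pi> f = f"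
    and \<pi>_sum: "\<forall>(x :: 'a \<Rightarrow> 'b) f. \<pi> (\<lambda>d. \<Sum>t\<in>B. x t * f t d) = (\<lambda>d. \<Sum>t\<in>B. x t * \<pi> (f t) d)"
    using exists_projection[OF sub finite_B] by (elim exE conjE)
  note \<pi> = \<pi>_in[rule_format] \<pi>_id[rule_format] \<pi>_sum[rule_format]
  have basis_carrier: "basis a \<in> carrier alg" if "a \<in> B" for a
    using that by (auto simp: alg_simps basis_def)
  have multI: "mult (basis a) f \<in> I" if "a \<in> B" "f \<in> I" for a f
    using I(4)[OF basis_carrier[OF that(1)] that(2)] by (simp add: alg_simps)
  have sumI: "(\<lambda>d. \<Sum>a\<in>A. f a d) \<in> I" if "\<And>a. a \<in> A \<Longrightarrow> f a \<in> I" for f and A :: "'a set"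
    using function_space.subspace_sum[OF sub that, of A] by (simp add: fun_eq_iff sum_fun_apply[abs_def])
  \<comment> \<open>The averaged projection sends \<open>x\<close> to the sum of
    \<open>s a b\<close> times \<open>a \<pi>(b x)\<close>; \<open>u\<close> is its value at the
    unit.\<close>
  define u where "u = (\<lambda>d. \<Sum>a\<in>B. \<Sum>b\<in>B. s a b * mult (basis a) (\<pi> (basis b)) d)"
  have "u \<in> I"
    unfolding u_def
    by (intro sumI function_space.subspace_scale[OF sub] multI \<pi>(1))
  moreover have "mult x u d = x d" if x: "x \<in> I" for x d
  proof -
    have xB: "\<And>d. d \<notin> B \<Longrightarrow> x d = 0" using x I(1) by (auto simp: alg_simps)
    have x_eq: "x = (\<lambda>d. \<Sum>t\<in>B. x t * basis t d)"
      by (rule ext, rule basis_expansion[OF finite_B xB])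
    have basis2: "mult (basis a) (mult (basis b) f) d = w a b * mult (basis (a \<star> b)) f d"
      if "a \<in> B" "b \<in> B" for a b f d
      unfolding mult_assoc[symmetric] mult_basis[OF that] by (rule mult_scale_left)
    have expand: "mult x f d = (\<Sum>t\<in>B. x t * mult (basis t) f d)" for f d
    proof -
      have "mult x f d = mult (\<lambda>d. \<Sum>t\<in>B. x t * basis t d) f d" using x_eq by simp
      then show ?thesis by (simp only: mult_sum_left mult_scale_left)
    qed
    have expand': "mult f x d = (\<Sum>t\<in>B. x t * mult f (basis t) d)" for f d
    proof -
      have "mult f x d = mult f (\<lambda>d. \<Sum>t\<in>B. x t * basis t d) d" using x_eq by simp
      then show ?thesis by (simp only: mult_sum_right mult_scale_right)
    qed
    \<comment> \<open>For \<open>x\<close> in \<open>I\<close> the product of \<open>b\<close> with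
      \<open>x\<close> is again in \<open>I\<close>, where \<open>\<pi>\<close> is the
      identity.\<close>
    have proj: "(\<lambda>d. \<Sum>t\<in>B. (x t * w b t) * \<pi> (basis (b \<star> t)) d) = mult (basis b) x" if b: "b \<in> B" for b
    proof -
      have "(\<lambda>d. \<Sum>t\<in>B. (x t * w b t) * \<pi> (basis (b \<star> t)) d) =
          \<pi> (\<lambda>d. \<Sum>t\<in>B. (x t * w b t) * basis (b \<star> t) d)"
        by (rule \<pi>(3)[symmetric])
      also have "(\<lambda>d. \<Sum>t\<in>B. (x t * w b t) * basis (b \<star> t) d) = mult (basis b) x"
        unfolding fun_eq_iff expand' by (intro allI sum.cong refl) (simp add: mult_basis b mult.assoc)
      also have "\<pi> (mult (basis b) x) = mult (basis b) x"
        by (rule \<pi>(2)[OF multI[OF b x]])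
      finally show ?thesis .
    qed
    have basis_u: "mult (basis t) u d = (\<Sum>a\<in>B. \<Sum>b\<in>B. s a b * w t a * mult (basis (t \<star> a)) (\<pi> (basis b)) d)"
      if "t \<in> B" for t
      unfolding u_def mult_sum_right mult_scale_right
      using that by (intro sum.cong refl) (simp add: basis2 mult.assoc)
    have "mult x u d = (\<Sum>t\<in>B. x t * mult (basis t) u d)"
      by (rule expand)
    also have "\<dots> = (\<Sum>t\<in>B. x t * (\<Sum>a\<in>B. \<Sum>b\<in>B. s a b * w t a * mult (basis (t \<star> a)) (\<pi> (basis b)) d))"
      by (intro sum.cong refl) (simp only: basis_u)
    \<comment> \<open>The Casimir identity moves \<open>t\<close> from the left tensor factor into
      the argument of \<open>\<pi>\<close>, so right multiplication by \<open>u\<close> becomes the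
      averaged projection at \<open>x\<close>.\<close>
    also have "\<dots> = (\<Sum>t\<in>B. x t * (\<Sum>a\<in>B. \<Sum>b\<in>B. s a b * w b t * mult (basis a) (\<pi> (basis (b \<star> t))) d))"
      by (intro sum.cong refl arg_cong[of _ _ "\<lambda>y. _ * y"] casimir)
    also have "\<dots> = (\<Sum>t\<in>B. \<Sum>a\<in>B. \<Sum>b\<in>B. s a b * ((x t * w b t) * mult (basis a) (\<pi> (basis (b \<star> t))) d))"
      unfolding sum_distrib_left by (intro sum.cong refl) (simp only: mult_ac)
    also have "\<dots> = (\<Sum>a\<in>B. \<Sum>t\<in>B. \<Sum>b\<in>B. s a b * ((x t * w b t) * mult (basis a) (\<pi> (basis (b \<star> t))) d))"
      by (rule sum.swap)
    also have "\<dots> = (\<Sum>a\<in>B. \<Sum>b\<in>B. \<Sum>t\<in>B. s a b * ((x t * w b t) * mult (basis a) (\<pi> (basis (b \<star> t))) d))"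
      by (rule sum.cong[OF refl], rule sum.swap)
    also have "\<dots> = (\<Sum>a\<in>B. \<Sum>b\<in>B. s a b * mult (basis a) (\<lambda>d. \<Sum>t\<in>B. (x t * w b t) * \<pi> (basis (b \<star> t)) d) d)"
      by (simp only: sum_distrib_left mult_sum_right mult_scale_right)
    also have "\<dots> = (\<Sum>a\<in>B. \<Sum>b\<in>B. s a b * w a b * mult (basis (a \<star> b)) x d)"
      by (intro sum.cong refl) (simp only: proj, simp only: basis2 mult.assoc)
    also have "\<dots> = mult (\<lambda>d. \<Sum>a\<in>B. \<Sum>b\<in>B. s a b * w a b * basis (a \<star> b) d) x d"
      by (simp only: mult_sum_left mult_scale_left)
    also have "\<dots> = x d"
      unfolding casimir_product by (simp add: mult_unit_left[OF xB])
    finally show ?thesis .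
  qed
  ultimately show ?thesis
    by (intro bexI[of _ u] ballI) (simp_all add: alg_simps fun_eq_iff)
qed

theorem semisimple_alg: "semisimple_algebra (ring_of_type_algebra :: 'b ring) alg"
proof -
  interpret ring alg by (rule ring_alg)
  have "semisimple_ring alg"
  proof (rule semisimple_ringI[where \<mu> = function_space.dim])
    fix I J assume I: "left_ideal I alg" and J: "left_ideal J alg" and "I \<subset> J"
    then show "function_space.dim I < function_space.dim J"
      using left_idealD(1)[OF J]
      by (intro dim_strict_mono[OF finite_B] left_ideal_subspace) (auto simp: alg_simps)
  qed (rule left_ideal_right_unit)
  then show ?thesis
    unfolding semisimple_algebra_def using assoc_unital_algebra_alg by simp
qed

end

section \<open>Determinants\<close>

text \<open>Passes from an index set to numbered rows and columns by an enumeration, for the sake of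
  the determinant.\<close>

definition mat_on :: "'b list \<Rightarrow> ('b \<Rightarrow> 'b \<Rightarrow> 'k) \<Rightarrow> 'k mat" where
  "mat_on bs F = mat (length bs) (length bs) (\<lambda>(i, j). F (bs ! i) (bs ! j))"

lemma mat_on_carrier [simp]: "mat_on bs F \<in> carrier_mat (length bs) (length bs)"
  by (simp add: mat_on_def)

lemma det_mat_on_hom:
  assumes "comm_ring_hom h"
  shows "det (mat_on bs (\<lambda>a b. h (F a b))) = h (det (mat_on bs F))"
proof -
  interpret comm_ring_hom h by fact
  have "mat_on bs (\<lambda>a b. h (F a b)) = map_mat h (mat_on bs F)"
    by (rule eq_matI) (simp_all add: mat_on_def)
  then show ?thesis by simp
qed

lemma sum_nth:
  assumes "distinct bs"
  shows "(\<Sum>b\<in>set bs. f b) = (\<Sum>i<length bs. f (bs ! i))"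
  by (rule sum.reindex_bij_betw[OF bij_betw_nth[OF assms], symmetric]) auto

lemma right_inverse_of_det:
  fixes F :: "'b \<Rightarrow> 'b \<Rightarrow> 'k::field"
  assumes bs: "distinct bs" and det: "det (mat_on bs F) \<noteq> 0"
  obtains s where "\<And>a c. a \<in> set bs \<Longrightarrow> c \<in> set bs \<Longrightarrow> matmul (set bs) F s a c = of_bool (a = c)"
proof -
  let ?n = "length bs"
  obtain V where V: "V \<in> carrier_mat ?n ?n" "mat_on bs F * V = 1\<^sub>m ?n"
    using det_non_zero_imp_unit[OF mat_on_carrier det, of "TYPE('k)"]
    by (auto simp: Units_def ring_mat_simps)
  define idx where "idx = the_inv_into {..<?n} ((!) bs)"
  have idx: "idx (bs ! i) = i" if "i < ?n" for i
    unfolding idx_def using that bs by (intro the_inv_into_f_f) (auto simp: inj_on_def nth_eq_iff_index_eq)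
  define s where "s = (\<lambda>a c. V $$ (idx a, idx c))"
  show thesis
  proof
    fix a c assume "a \<in> set bs" "c \<in> set bs"
    then obtain i j where ij: "i < ?n" "a = bs ! i" "j < ?n" "c = bs ! j"
      by (auto simp: in_set_conv_nth)
    have "matmul (set bs) F s a c = (\<Sum>l<?n. F (bs ! i) (bs ! l) * V $$ (l, j))"
      unfolding matmul_def sum_nth[OF bs] using ij by (intro sum.cong refl) (simp add: s_def idx)
    also have "\<dots> = (mat_on bs F * V) $$ (i, j)"
      using ij V(1) by (simp add: mat_on_def scalar_prod_def atLeast0LessThan)
    also have "\<dots> = of_bool (a = c)"
      unfolding V(2) using ij bs by (simp add: nth_eq_iff_index_eq)
    finally show "matmul (set bs) F s a c = of_bool (a = c)" .
  qed
qed

lemma det_mat_on_nonzero: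
  fixes F :: "'b \<Rightarrow> 'b \<Rightarrow> 'k::field"
  assumes bs: "distinct bs"
    and ker: "\<And>v b. (\<And>a. a \<in> set bs \<Longrightarrow> (\<Sum>b\<in>set bs. F a b * v b) = 0) \<Longrightarrow> b \<in> set bs \<Longrightarrow> v b = 0"
  shows "det (mat_on bs F) \<noteq> 0"
proof
  let ?n = "length bs"
  assume "det (mat_on bs F) = 0"
  then obtain u where u: "u \<in> carrier_vec ?n" "u \<noteq> 0\<^sub>v ?n" "mat_on bs F *\<^sub>v u = 0\<^sub>v ?n"
    using det_0_iff_vec_prod_zero_field[OF mat_on_carrier] by blast
  define idx where "idx = the_inv_into {..<?n} ((!) bs)"
  have idx: "idx (bs ! i) = i" if "i < ?n" for i
    unfolding idx_def using that bs by (intro the_inv_into_f_f) (auto simp: inj_on_def nth_eq_iff_index_eq)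
  have zero: "(\<Sum>b\<in>set bs. F a b * u $ idx b) = 0" if a: "a \<in> set bs" for a
  proof -
    obtain i where i: "i < ?n" "a = bs ! i" using a by (auto simp: in_set_conv_nth)
    have "(\<Sum>b\<in>set bs. F a b * u $ idx b) = (\<Sum>l<?n. F (bs ! i) (bs ! l) * u $ l)"
      unfolding sum_nth[OF bs] using i by (intro sum.cong refl) (simp add: idx)
    also have "\<dots> = (mat_on bs F *\<^sub>v u) $ i"
      using i u(1) by (simp add: mat_on_def scalar_prod_def atLeast0LessThan)
    also have "\<dots> = 0" unfolding u(3) using i by simp
    finally show ?thesis .
  qed
  have "u $ i = 0" if i: "i < ?n" for i
    using ker[of "\<lambda>b. u $ idx b" "bs ! i", OF zero nth_mem[OF i]] idx[OF i] by simp
  then have "u = 0\<^sub>v ?n" using u(1) by (intro eq_vecI) auto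
  with u(2) show False by blast
qed

definition trace_on :: "'a set \<Rightarrow> ('a \<Rightarrow> 'a \<Rightarrow> 'k::comm_ring_1) \<Rightarrow> 'k" where
  "trace_on A F = (\<Sum>a\<in>A. F a a)"

text \<open>Cyclicity for rectangular factors: in \<open>trace_form_kernel\<close> it trades a trace
  over pairs of positions for one over the basis.\<close>

lemma trace_on_matmul: "trace_on A (matmul B F G) = trace_on B (matmul A G F)"
  unfolding trace_on_def matmul_def by (subst sum.swap) (simp add: mult.commute)

lemma trace_on_cong: "(\<And>a. a \<in> A \<Longrightarrow> F a a = G a a) \<Longrightarrow> trace_on A F = trace_on A G"
  by (simp add: trace_on_def)

section \<open>Representations closed under transposition\<close>

locale star_representation = twisted_monoid B cmp w e
  for B :: "'b set" and cmp :: "'b \<Rightarrow> 'b \<Rightarrow> 'b" (infixl \<open>\<star>\<close> 70)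
    and w :: "'b \<Rightarrow> 'b \<Rightarrow> real" and e :: 'b +
  fixes P :: "'p set" and \<rho> :: "'b \<Rightarrow> 'p \<Rightarrow> 'p \<Rightarrow> real" and star :: "'b \<Rightarrow> 'b"
  assumes finite_P: "finite P"
    and rep: "\<And>a b p q. a \<in> B \<Longrightarrow> b \<in> B \<Longrightarrow> p \<in> P \<Longrightarrow> q \<in> P \<Longrightarrow>
      (\<Sum>r\<in>P. \<rho> a p r * \<rho> b r q) = w a b * \<rho> (a \<star> b) p q"
    and star_in: "\<And>a. a \<in> B \<Longrightarrow> star a \<in> B"
    and rep_star: "\<And>a p q. a \<in> B \<Longrightarrow> p \<in> P \<Longrightarrow> q \<in> P \<Longrightarrow> \<rho> (star a) p q = \<rho> a q p"
    and faithful: "\<And>v b. (\<And>p q. p \<in> P \<Longrightarrow> q \<in> P \<Longrightarrow> (\<Sum>b\<in>B. v b * \<rho> b p q) = 0) \<Longrightarrow> b \<in> B \<Longrightarrow> v b = 0"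
begin

text \<open>Each matrix \<open>\<rho> b\<close> is flattened into a column indexed by positions. The
  columns are coordinates of the embedding into all matrices, so \<open>gram\<close> below is their
  Gram matrix for the Frobenius inner product.\<close>

definition S :: "'p \<times> 'p \<Rightarrow> 'b \<Rightarrow> real" where
  "S r b = \<rho> b (fst r) (snd r)"

definition gram :: "'b \<Rightarrow> 'b \<Rightarrow> real" where
  "gram = matmul (P \<times> P) (\<lambda>a r. S r a) S"

definition act :: "('b \<Rightarrow> real) \<Rightarrow> 'b \<Rightarrow> 'b \<Rightarrow> real" where
  "act v c b = (\<Sum>a\<in>B. v a * left_matrix (\<star>) w a c b)"

text \<open>The coefficients of \<open>v\<close> are placed on the elements \<open>star a\<close>:
  left multiplication by the transpose of \<open>v\<close>.\<close>

definition act_star :: "('b \<Rightarrow> real) \<Rightarrow> 'b \<Rightarrow> 'b \<Rightarrow> real" where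
  "act_star v c b = (\<Sum>a\<in>B. v a * left_matrix (\<star>) w (star a) c b)"

lemma rep_left_matrix:
  assumes "a \<in> B" "b \<in> B" "p \<in> P" "q \<in> P"
  shows "(\<Sum>c\<in>B. \<rho> c p q * left_matrix (\<star>) w a c b) = (\<Sum>r\<in>P. \<rho> a p r * \<rho> b r q)"
proof -
  have "(\<Sum>c\<in>B. \<rho> c p q * left_matrix (\<star>) w a c b) = (\<Sum>c\<in>B. if a \<star> b = c then w a b * \<rho> c p q else 0)"
    unfolding left_matrix_def by (intro sum.cong refl) simp
  then show ?thesis using assms by (simp add: sum.delta finite_B closed rep)
qed

text \<open>Since \<open>\<rho>\<close> is multiplicative up to weights, \<open>S\<close>
  intertwines the abstract left multiplication with the product by the actual matrix of
  \<open>v\<close>.\<close>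

lemma S_act:
  assumes "b \<in> B" "p \<in> P" "q \<in> P"
  shows "matmul B S (act v) (p, q) b = (\<Sum>a\<in>B. v a * (\<Sum>r\<in>P. \<rho> a p r * \<rho> b r q))"
proof -
  have "matmul B S (act v) (p, q) b = (\<Sum>c\<in>B. \<Sum>a\<in>B. v a * (\<rho> c p q * left_matrix (\<star>) w a c b))"
    unfolding matmul_def act_def S_def sum_distrib_left by (intro sum.cong refl) simp
  also have "\<dots> = (\<Sum>a\<in>B. \<Sum>c\<in>B. v a * (\<rho> c p q * left_matrix (\<star>) w a c b))"
    by (rule sum.swap)
  also have "\<dots> = (\<Sum>a\<in>B. v a * (\<Sum>r\<in>P. \<rho> a p r * \<rho> b r q))"
    using assms by (intro sum.cong refl) (simp add: sum_distrib_left[symmetric] rep_left_matrix)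
  finally show ?thesis .
qed

lemma S_act_star:
  assumes "b \<in> B" "p \<in> P" "q \<in> P"
  shows "matmul B S (act_star v) (p, q) b = (\<Sum>a\<in>B. v a * (\<Sum>r\<in>P. \<rho> a r p * \<rho> b r q))"
proof -
  have "matmul B S (act_star v) (p, q) b =
      (\<Sum>c\<in>B. \<Sum>a\<in>B. v a * (\<rho> c p q * left_matrix (\<star>) w (star a) c b))"
    unfolding matmul_def act_star_def S_def sum_distrib_left by (intro sum.cong refl) simp
  also have "\<dots> = (\<Sum>a\<in>B. \<Sum>c\<in>B. v a * (\<rho> c p q * left_matrix (\<star>) w (star a) c b))"
    by (rule sum.swap)
  also have "\<dots> = (\<Sum>a\<in>B. v a * (\<Sum>r\<in>P. \<rho> (star a) p r * \<rho> b r q))"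
    using assms by (intro sum.cong refl) (simp add: sum_distrib_left[symmetric] rep_left_matrix star_in)
  also have "\<dots> = (\<Sum>a\<in>B. v a * (\<Sum>r\<in>P. \<rho> a r p * \<rho> b r q))"
    using assms by (intro sum.cong refl arg_cong[of _ _ "\<lambda>y. _ * y"]) (simp add: rep_star)
  finally show ?thesis .
qed

text \<open>For the Frobenius inner product, the adjoint of left multiplication by \<open>a\<close> is left
  multiplication by \<open>star a\<close>.\<close>

lemma gram_adjoint:
  assumes ab: "a \<in> B" "b \<in> B"
  shows "matmul B gram (act_star v) a b = matmul B (\<lambda>x y. act v y x) gram a b"
proof -
  \<comment> \<open>The fully expanded inner product; both sides are its sum over \<open>p\<close>,
    \<open>q\<close>, \<open>x\<close>, \<open>r\<close>, grouped differently.\<close>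
  let ?h = "\<lambda>x p q r. v x * \<rho> a p q * \<rho> x r p * \<rho> b r q"
  have "matmul B gram (act_star v) a b = matmul (P \<times> P) (\<lambda>a r. S r a) (matmul B S (act_star v)) a b"
    by (simp only: gram_def matmul_assoc)
  also have "\<dots> = (\<Sum>p\<in>P. \<Sum>q\<in>P. S (p, q) a * matmul B S (act_star v) (p, q) b)"
    unfolding matmul_def[of "P \<times> P"] sum.cartesian_product by (intro sum.cong refl) auto
  also have "\<dots> = (\<Sum>p\<in>P. \<Sum>q\<in>P. \<Sum>x\<in>B. \<Sum>r\<in>P. ?h x p q r)"
  proof (intro sum.cong refl)
    fix p q assume "p \<in> P" "q \<in> P"
    then show "S (p, q) a * matmul B S (act_star v) (p, q) b = (\<Sum>x\<in>B. \<Sum>r\<in>P. ?h x p q r)"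
      unfolding S_act_star[OF ab(2) \<open>p \<in> P\<close> \<open>q \<in> P\<close>] by (simp add: S_def sum_distrib_left mult_ac)
  qed
  also have "\<dots> = (\<Sum>q\<in>P. \<Sum>p\<in>P. \<Sum>x\<in>B. \<Sum>r\<in>P. ?h x p q r)"
    by (rule sum.swap)
  also have "\<dots> = (\<Sum>q\<in>P. \<Sum>x\<in>B. \<Sum>p\<in>P. \<Sum>r\<in>P. ?h x p q r)"
    by (rule sum.cong[OF refl], rule sum.swap)
  also have "\<dots> = (\<Sum>q\<in>P. \<Sum>x\<in>B. \<Sum>r\<in>P. \<Sum>p\<in>P. ?h x p q r)"
    by (rule sum.cong[OF refl], rule sum.cong[OF refl], rule sum.swap)
  also have "\<dots> = (\<Sum>q\<in>P. \<Sum>r\<in>P. \<Sum>x\<in>B. \<Sum>p\<in>P. ?h x p q r)"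
    by (rule sum.cong[OF refl], rule sum.swap)
  also have "\<dots> = (\<Sum>r\<in>P. \<Sum>q\<in>P. \<Sum>x\<in>B. \<Sum>p\<in>P. ?h x p q r)"
    by (rule sum.swap)
  also have "\<dots> = (\<Sum>r\<in>P. \<Sum>q\<in>P. matmul B S (act v) (r, q) a * S (r, q) b)"
  proof (intro sum.cong refl)
    fix r q assume "r \<in> P" "q \<in> P"
    then show "(\<Sum>x\<in>B. \<Sum>p\<in>P. ?h x p q r) = matmul B S (act v) (r, q) a * S (r, q) b"
      unfolding S_act[OF ab(1) \<open>r \<in> P\<close> \<open>q \<in> P\<close>]
      by (simp add: S_def sum_distrib_left sum_distrib_right mult_ac)
  qed
  also have "\<dots> = matmul (P \<times> P) (\<lambda>a r. matmul B S (act v) r a) S a b"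
    unfolding matmul_def[of "P \<times> P"] sum.cartesian_product by (intro sum.cong refl) auto
  also have "(\<lambda>a r. matmul B S (act v) r a) = matmul B (\<lambda>x y. act v y x) (\<lambda>a r. S r a)"
    by (intro ext) (simp add: matmul_def mult.commute)
  also have "matmul (P \<times> P) \<dots> S a b = matmul B (\<lambda>x y. act v y x) gram a b"
    by (simp only: gram_def matmul_assoc)
  finally show ?thesis .
qed

lemma faithful_S:
  assumes "\<And>r. r \<in> P \<times> P \<Longrightarrow> (\<Sum>b\<in>B. S r b * v b) = 0" "b \<in> B"
  shows "v b = 0"
  using assms(1)[of "(p, q)" for p q] assms(2)
  by (intro faithful[of v]) (simp_all add: S_def mult.commute)

lemma gram_sym: "gram a b = gram b a"
  unfolding gram_def matmul_def by (simp add: mult.commute)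

text \<open>Pairing \<open>gram\<close> applied to \<open>v\<close> with \<open>v\<close> gives the
  squared norm of \<open>S\<close> applied to \<open>v\<close>. Over the reals a vanishing sum of
  squares vanishes termwise, and faithfulness finishes.\<close>

lemma gram_kernel:
  assumes ker: "\<And>a. a \<in> B \<Longrightarrow> (\<Sum>b\<in>B. gram a b * v b) = 0" and "b \<in> B"
  shows "v b = 0"
proof (rule faithful_S[OF _ assms(2)])
  have "(\<Sum>r\<in>P \<times> P. (\<Sum>b\<in>B. S r b * v b)\<^sup>2) = (\<Sum>r\<in>P \<times> P. \<Sum>a\<in>B. \<Sum>b\<in>B. v a * (S r a * S r b * v b))"
    unfolding power2_eq_square sum_product by (intro sum.cong refl) simp
  also have "\<dots> = (\<Sum>a\<in>B. \<Sum>r\<in>P \<times> P. \<Sum>b\<in>B. v a * (S r a * S r b * v b))"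
    by (rule sum.swap)
  also have "\<dots> = (\<Sum>a\<in>B. \<Sum>b\<in>B. \<Sum>r\<in>P \<times> P. v a * (S r a * S r b * v b))"
    by (rule sum.cong[OF refl], rule sum.swap)
  also have "\<dots> = (\<Sum>a\<in>B. v a * (\<Sum>b\<in>B. gram a b * v b))"
    by (simp only: gram_def matmul_def sum_distrib_left sum_distrib_right)
  also have "\<dots> = 0" using ker by simp
  finally have sq: "\<forall>r\<in>P \<times> P. (\<Sum>b\<in>B. S r b * v b)\<^sup>2 = 0"
    using finite_P by (subst (asm) sum_nonneg_eq_0_iff) auto
  show "(\<Sum>b\<in>B. S r b * v b) = 0" if "r \<in> P \<times> P" for r
    using bspec[OF sq that] by simp
qed

text \<open>The trace is a combination of the values of the form between \<open>star a\<close> and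
  \<open>v\<close>, all zero by hypothesis because \<open>star\<close> maps the basis to
  itself.\<close>

lemma trace_act:
  assumes ker: "\<And>a. a \<in> B \<Longrightarrow> (\<Sum>b\<in>B. T a b * v b) = 0"
  shows "trace_on B (matmul B (act_star v) (act v)) = 0"
proof -
  have "trace_on B (matmul B (act_star v) (act v)) =
      (\<Sum>d\<in>B. \<Sum>c\<in>B. \<Sum>a\<in>B. \<Sum>b\<in>B. v a * v b * (left_matrix (\<star>) w (star a) d c * left_matrix (\<star>) w b c d))"
    unfolding trace_on_def matmul_def act_def act_star_def sum_product
    by (intro sum.cong refl) simp
  also have "\<dots> = (\<Sum>d\<in>B. \<Sum>a\<in>B. \<Sum>c\<in>B. \<Sum>b\<in>B. v a * v b * (left_matrix (\<star>) w (star a) d c * left_matrix (\<star>) w b c d))"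
    by (rule sum.cong[OF refl], rule sum.swap)
  also have "\<dots> = (\<Sum>d\<in>B. \<Sum>a\<in>B. \<Sum>b\<in>B. \<Sum>c\<in>B. v a * v b * (left_matrix (\<star>) w (star a) d c * left_matrix (\<star>) w b c d))"
    by (rule sum.cong[OF refl], rule sum.cong[OF refl], rule sum.swap)
  also have "\<dots> = (\<Sum>a\<in>B. \<Sum>d\<in>B. \<Sum>b\<in>B. \<Sum>c\<in>B. v a * v b * (left_matrix (\<star>) w (star a) d c * left_matrix (\<star>) w b c d))"
    by (rule sum.swap)
  also have "\<dots> = (\<Sum>a\<in>B. \<Sum>b\<in>B. \<Sum>d\<in>B. \<Sum>c\<in>B. v a * v b * (left_matrix (\<star>) w (star a) d c * left_matrix (\<star>) w b c d))"
    by (rule sum.cong[OF refl], rule sum.swap)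
  also have "\<dots> = (\<Sum>a\<in>B. \<Sum>b\<in>B. v a * v b * T (star a) b)"
    by (simp only: trace_form_def sum_distrib_left)
  also have "\<dots> = (\<Sum>a\<in>B. v a * (\<Sum>b\<in>B. T (star a) b * v b))"
    unfolding sum_distrib_left by (intro sum.cong refl) simp
  also have "\<dots> = 0" using ker star_in by simp
  finally show ?thesis .
qed

text \<open>With \<open>H\<close> the inverse of the Gram matrix \<open>G = S\<^sup>T S\<close> and \<open>M\<close> the matrix of \<open>v\<close>, the trace of
  \<open>star v\<close> times \<open>v\<close> is the squared Frobenius norm of \<open>S H M\<^sup>T S\<^sup>T\<close>.\<close>

theorem trace_form_kernel:
  assumes ker: "\<And>a. a \<in> B \<Longrightarrow> (\<Sum>b\<in>B. T a b * v b) = 0" and "b \<in> B"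
  shows "v b = 0"
proof -
  obtain bs where bs: "distinct bs" "set bs = B"
    using finite_distinct_list[OF finite_B] by blast
  have "det (mat_on bs gram) \<noteq> 0"
    using gram_kernel by (intro det_mat_on_nonzero bs(1)) (simp add: bs(2))
  from right_inverse_of_det[OF bs(1) this] obtain H where
    GH: "\<And>a c. a \<in> B \<Longrightarrow> c \<in> B \<Longrightarrow> matmul B gram H a c = of_bool (a = c)"
    unfolding bs(2) by blast
  note H = symmetric_inverse[OF finite_B gram_sym GH]
  define M where "M = act v"
  define Mt where "Mt = (\<lambda>x y. act v y x)"
  define St where "St = (\<lambda>a r. S r a)"
  define U where "U = matmul B H (matmul B Mt St)"
  define Ut where "Ut = (\<lambda>r b. U b r)"
  let ?R = "P \<times> P"
  have G: "gram = matmul ?R St S" by (simp only: gram_def St_def)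
  have GU: "matmul B gram U a r = matmul B Mt St a r" if "a \<in> B" for a r
  proof -
    have "matmul B gram U a r = matmul B (matmul B gram H) (matmul B Mt St) a r"
      by (simp only: U_def matmul_assoc)
    then show ?thesis using that by (simp add: matmul_id_left[OF finite_B] GH)
  qed
  have Ut: "Ut r b = matmul B (matmul B S M) H r b" if "b \<in> B" for r b
    unfolding Ut_def U_def matmul_def[of B H] matmul_def[of B "matmul B S M"]
    using that by (intro sum.cong refl)
      (simp add: H(1)[of b] matmul_def Mt_def St_def M_def mult.commute)
  \<comment> \<open>The chain uses \<open>gram H = 1\<close> to remove \<open>U\<close>, then
    cyclicity, then the adjoint relation to replace \<open>Mt gram\<close> by
    \<open>gram (act_star v)\<close>, and finally \<open>H gram = 1\<close>.\<close>
  have "(\<Sum>r\<in>?R. \<Sum>r'\<in>?R. (matmul B S U r' r)\<^sup>2) =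
      trace_on ?R (matmul ?R (matmul B Ut St) (matmul B S U))"
    unfolding trace_on_def matmul_def[of ?R]
    by (intro sum.cong refl) (simp add: matmul_def Ut_def St_def power2_eq_square mult.commute)
  also have "\<dots> = trace_on ?R (matmul B Ut (matmul B gram U))"
    by (simp only: G matmul_assoc)
  also have "\<dots> = trace_on ?R (matmul B (matmul B (matmul B S M) H) (matmul B Mt St))"
    by (intro trace_on_cong) (simp add: matmul_def[of B Ut] matmul_def[of B "matmul B (matmul B S M) H"] Ut GU)
  also have "\<dots> = trace_on B (matmul ?R (matmul B Mt St) (matmul B (matmul B S M) H))"
    by (rule trace_on_matmul)
  also have "\<dots> = trace_on B (matmul B (matmul B (matmul B Mt gram) M) H)"
    by (simp only: G matmul_assoc)
  also have "\<dots> = trace_on B (matmul B (matmul B (matmul B gram (act_star v)) M) H)"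
    unfolding Mt_def
    by (intro trace_on_cong matmul_cong_left) (simp add: gram_adjoint)
  also have "\<dots> = trace_on B (matmul B H (matmul B (matmul B gram (act_star v)) M))"
    by (rule trace_on_matmul)
  also have "\<dots> = trace_on B (matmul B (matmul B H gram) (matmul B (act_star v) M))"
    by (simp only: matmul_assoc)
  also have "\<dots> = trace_on B (matmul B (act_star v) M)"
    by (intro trace_on_cong matmul_id_left finite_B H(2))
  also have "\<dots> = 0"
    unfolding M_def by (rule trace_act[OF ker])
  finally have sq: "\<forall>r\<in>?R. \<forall>r'\<in>?R. (matmul B S U r' r)\<^sup>2 = 0"
    using finite_P by (simp add: sum_nonneg_eq_0_iff sum_nonneg)
  have SU: "matmul B S U r' r = 0" if "r \<in> ?R" "r' \<in> ?R" for r r'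
    using bspec[OF bspec[OF sq that(1)] that(2)] by simp
  \<comment> \<open>From \<open>S U = 0\<close> follows
    \<open>Mt St = gram U = St (S U) = 0\<close>. Its row at the unit is \<open>S\<close> applied to
    \<open>v\<close>, because the column of \<open>act v\<close> at \<open>e\<close> is
    \<open>v\<close>.\<close>
  have "(\<Sum>c\<in>B. S r c * v c) = 0" if r: "r \<in> ?R" for r
  proof -
    have act_e: "act v c e = v c" if "c \<in> B" for c
    proof -
      have "act v c e = (\<Sum>a\<in>B. if a = c then v a else 0)"
        unfolding act_def left_matrix_def using that by (intro sum.cong refl) (simp add: e_right w_right)
      then show ?thesis using that by (simp add: sum.delta finite_B)
    qed
    have "(\<Sum>c\<in>B. S r c * v c) = matmul B Mt St e r"
      unfolding matmul_def by (intro sum.cong refl) (simp add: Mt_def St_def act_e)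
    also have "\<dots> = matmul ?R St (matmul B S U) e r"
      unfolding GU[OF e_in, symmetric] G matmul_assoc ..
    also have "\<dots> = 0"
      unfolding matmul_def[of ?R] using SU[OF r] by (intro sum.neutral ballI) simp
    finally show ?thesis .
  qed
  then show ?thesis by (rule faithful_S[OF _ assms(2)])
qed

end

section \<open>Ramified partitions\<close>

lemma trace_form_hom:
  assumes "comm_ring_hom h"
  shows "trace_form B cmp (\<lambda>a b. h (w a b)) = (\<lambda>a b. h (trace_form B cmp w a b))"
proof -
  interpret comm_ring_hom h by fact
  have "left_matrix cmp (\<lambda>a b. h (w a b)) x c d = h (left_matrix cmp w x c d)" for x c d
    by (simp add: left_matrix_def)
  then show ?thesis by (intro ext) (simp add: trace_form_def hom_distribs)
qed

definition comp2 :: "nat \<Rightarrow> vertex rel \<times> vertex rel \<Rightarrow> vertex rel \<times> vertex rel \<Rightarrow> vertex rel \<times> vertex rel" where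
  "comp2 n a b = (partition_comp n (fst a) (fst b), partition_comp n (snd a) (snd b))"

definition weight2 :: "nat \<Rightarrow> 'k::comm_ring_1 \<Rightarrow> 'k \<Rightarrow> vertex rel \<times> vertex rel \<Rightarrow> vertex rel \<times> vertex rel \<Rightarrow> 'k" where
  "weight2 n q1 q2 a b = q1 ^ middle_parts n (fst a) (fst b) * q2 ^ middle_parts n (snd a) (snd b)"

definition unit2 :: "nat \<Rightarrow> vertex rel \<times> vertex rel" where
  "unit2 n = (identity_partition n, identity_partition n)"

lemma ramified_partition_algebra_eq:
  "ramified_partition_algebra n Q1 Q2 =
    twisted_algebra (ramified_partitions n) (comp2 n) (weight2 n Q1 Q2) (unit2 n)"
proof -
  have "ramified_mult n Q1 Q2 = twisted_mult (ramified_partitions n) (comp2 n) (weight2 n Q1 Q2)"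
    by (intro ext) (simp add: ramified_mult_def twisted_mult_def comp2_def weight2_def case_prod_unfold cong: if_cong)
  then show ?thesis
    by (simp add: ramified_partition_algebra_def twisted_algebra_def unit2_def basis_def fun_eq_iff)
qed

lemma ramified_partitionsD:
  assumes "a \<in> ramified_partitions n"
  shows "fst a \<in> partitions n" "snd a \<in> partitions n" "fst a \<subseteq> snd a"
  using assms by (auto simp: ramified_partitions_eq)

lemma ramified_partitionsI:
  "fst a \<in> partitions n \<Longrightarrow> snd a \<in> partitions n \<Longrightarrow> fst a \<subseteq> snd a \<Longrightarrow> a \<in> ramified_partitions n"
  by (cases a) (simp add: ramified_partitions_eq)

text \<open>The laws hold componentwise; the pairs stay ramified because composition is monotone in
  both arguments.\<close>

lemma twisted_monoid_ramified:
  "twisted_monoid (ramified_partitions n) (comp2 n) (weight2 n q1 q2) (unit2 n)"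
proof
  show "finite (ramified_partitions n)" by simp
  show "unit2 n \<in> ramified_partitions n"
    by (rule ramified_partitionsI) (simp_all add: unit2_def identity_partition_in_partitions)
  fix a b c assume a: "a \<in> ramified_partitions n"
  note a = ramified_partitionsD[OF a]
  show "comp2 n (unit2 n) a = a" "comp2 n a (unit2 n) = a"
    "weight2 n q1 q2 (unit2 n) a = 1" "weight2 n q1 q2 a (unit2 n) = 1"
    using a by (simp_all add: comp2_def unit2_def weight2_def partition_comp_identity)
  assume b: "b \<in> ramified_partitions n"
  note b = ramified_partitionsD[OF b]
  show "comp2 n a b \<in> ramified_partitions n"
    using a b by (intro ramified_partitionsI) (simp_all add: comp2_def partition_comp_in_partitions partition_comp_mono)
  assume c: "c \<in> ramified_partitions n"
  note c = ramified_partitionsD[OF c]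
  show "comp2 n (comp2 n a b) c = comp2 n a (comp2 n b c)"
    using a b c by (simp add: comp2_def partition_comp_assoc)
  have "weight2 n q1 q2 a b * weight2 n q1 q2 (comp2 n a b) c =
      q1 ^ (middle_parts n (fst a) (fst b) + middle_parts n (partition_comp n (fst a) (fst b)) (fst c)) *
      q2 ^ (middle_parts n (snd a) (snd b) + middle_parts n (partition_comp n (snd a) (snd b)) (snd c))"
    by (simp add: weight2_def comp2_def power_add mult_ac)
  also have "\<dots> = q1 ^ (middle_parts n (fst b) (fst c) + middle_parts n (fst a) (partition_comp n (fst b) (fst c))) *
      q2 ^ (middle_parts n (snd b) (snd c) + middle_parts n (snd a) (partition_comp n (snd b) (snd c)))"
    by (simp only: partition_comp_assoc(2)[OF a(1) b(1) c(1)] partition_comp_assoc(2)[OF a(2) b(2) c(2)])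
  also have "\<dots> = weight2 n q1 q2 b c * weight2 n q1 q2 a (comp2 n b c)"
    by (simp add: weight2_def comp2_def power_add mult_ac)
  finally show "weight2 n q1 q2 a b * weight2 n q1 q2 (comp2 n a b) c =
    weight2 n q1 q2 b c * weight2 n q1 q2 a (comp2 n b c)" .
qed

section \<open>Kronecker products of partition matrices, and their linear independence\<close>

definition entry2 ::
  "vertex rel \<times> vertex rel \<Rightarrow> (nat \<Rightarrow> nat) \<times> (nat \<Rightarrow> nat) \<Rightarrow> (nat \<Rightarrow> nat) \<times> (nat \<Rightarrow> nat) \<Rightarrow> real" where
  "entry2 a p q = of_bool (entry (fst a) (fst p) (fst q)) * of_bool (entry (snd a) (snd p) (snd q))"

text \<open>At the position given by kernel colourings of both components of \<open>d\<close>,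
  exactly the pairs below \<open>d\<close> have entry 1. Induction on the total size of the
  relations removes all of them but \<open>d\<close> itself.\<close>

lemma entry2_faithful:
  assumes N: "2 * n \<le> N"
    and zero: "\<And>p q. p \<in> words n N \<times> words n N \<Longrightarrow> q \<in> words n N \<times> words n N \<Longrightarrow>
      (\<Sum>b\<in>ramified_partitions n. v b * entry2 b p q) = 0"
    and "d \<in> ramified_partitions n"
  shows "v d = 0"
  using assms(3)
proof (induction "card (fst d) + card (snd d)" arbitrary: d rule: less_induct)
  case less
  note d = ramified_partitionsD[OF less.prems]
  obtain \<alpha>1 \<beta>1 where 1: "\<alpha>1 \<in> words n N" "\<beta>1 \<in> words n N"
    "\<forall>b\<in>partitions n. entry b \<alpha>1 \<beta>1 \<longleftrightarrow> b \<subseteq> fst d"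
    by (rule partition_is_kernel[OF d(1) N])
  obtain \<alpha>2 \<beta>2 where 2: "\<alpha>2 \<in> words n N" "\<beta>2 \<in> words n N"
    "\<forall>b\<in>partitions n. entry b \<alpha>2 \<beta>2 \<longleftrightarrow> b \<subseteq> snd d"
    by (rule partition_is_kernel[OF d(2) N])
  have fin: "finite (fst d)" "finite (snd d)"
    using d partitions_subset by (meson finite_SigmaI finite_UnI finite_row finite_subset)+
  have summand: "v b * entry2 b (\<alpha>1, \<alpha>2) (\<beta>1, \<beta>2) = (if b = d then v b else 0)"
    if bR: "b \<in> ramified_partitions n" for b
  proof -
    note b = ramified_partitionsD[OF bR]
    have e: "entry2 b (\<alpha>1, \<alpha>2) (\<beta>1, \<beta>2) = of_bool (fst b \<subseteq> fst d \<and> snd b \<subseteq> snd d)"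
      using b by (simp add: entry2_def 1(3) 2(3))
    consider "b = d" | "\<not> (fst b \<subseteq> fst d \<and> snd b \<subseteq> snd d)"
      | "fst b \<subseteq> fst d" "snd b \<subseteq> snd d" "fst b \<noteq> fst d \<or> snd b \<noteq> snd d"
      by (auto simp: prod_eq_iff)
    then show ?thesis
    proof cases
      case 3
      then have "card (fst b) + card (snd b) < card (fst d) + card (snd d)"
        using fin by (metis add_less_le_mono add_le_less_mono card_mono psubset_card_mono psubsetI)
      then have "v b = 0" using less.hyps bR by blast
      then show ?thesis using 3 by auto
    next
      case 1
      then show ?thesis using e by simp
    next
      case 2
      then show ?thesis using e by auto
    qed
  qed
  have "0 = (\<Sum>b\<in>ramified_partitions n. v b * entry2 b (\<alpha>1, \<alpha>2) (\<beta>1, \<beta>2))"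
    using 1 2 by (intro zero[symmetric]) simp_all
  also have "\<dots> = (\<Sum>b\<in>ramified_partitions n. if b = d then v b else 0)"
    by (intro sum.cong refl summand)
  also have "\<dots> = v d" using less.prems by (simp add: sum.delta)
  finally show ?case by simp
qed

lemma star_representation_ramified:
  assumes "2 * n \<le> N"
  shows "star_representation (ramified_partitions n) (comp2 n) (weight2 n (of_nat N) (of_nat N)) (unit2 n)
    (words n N \<times> words n N) entry2 (\<lambda>a. (flip (fst a), flip (snd a)))"
proof (intro star_representation.intro star_representation_axioms.intro twisted_monoid_ramified)
  let ?P = "words n N \<times> words n N"
  show "finite ?P" by simp
  show "v d = 0"
    if "\<And>p q. p \<in> ?P \<Longrightarrow> q \<in> ?P \<Longrightarrow> (\<Sum>b\<in>ramified_partitions n. v b * entry2 b p q) = 0"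
      "d \<in> ramified_partitions n" for v d
    using that by (rule entry2_faithful[OF assms])
  fix a b p q assume a: "a \<in> ramified_partitions n"
  note a = ramified_partitionsD[OF a]
  show "(flip (fst a), flip (snd a)) \<in> ramified_partitions n"
    using a by (intro ramified_partitionsI) (simp_all add: flip_in_partitions flip_mono)
  assume p: "p \<in> ?P" and q: "q \<in> ?P"
  show "entry2 (flip (fst a), flip (snd a)) p q = entry2 a q p"
    using a by (simp add: entry2_def entry_flip)
  assume b: "b \<in> ramified_partitions n"
  note b = ramified_partitionsD[OF b]
  have "(\<Sum>r\<in>?P. entry2 a p r * entry2 b r q) =
      (\<Sum>(\<gamma>, \<delta>)\<in>?P. (of_bool (entry (fst a) (fst p) \<gamma>) * of_bool (entry (fst b) \<gamma> (fst q))) *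
        (of_bool (entry (snd a) (snd p) \<delta>) * of_bool (entry (snd b) \<delta> (snd q))))"
    unfolding entry2_def case_prod_unfold by (intro sum.cong refl) (simp only: mult_ac)
  also have "\<dots> = (\<Sum>\<gamma>\<in>words n N. of_bool (entry (fst a) (fst p) \<gamma>) * of_bool (entry (fst b) \<gamma> (fst q))) *
      (\<Sum>\<delta>\<in>words n N. of_bool (entry (snd a) (snd p) \<delta>) * of_bool (entry (snd b) \<delta> (snd q)))"
    by (simp only: sum_product sum.cartesian_product)
  also have "\<dots> = weight2 n (of_nat N) (of_nat N) a b * entry2 (comp2 n a b) p q"
    using p q a b by (subst (1 2) sum_entry_entry) (auto simp: weight2_def entry2_def comp2_def mult_ac)
  finally show "(\<Sum>r\<in>?P. entry2 a p r * entry2 b r q) =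
    weight2 n (of_nat N) (of_nat N) a b * entry2 (comp2 n a b) p q" .
qed

text \<open>Defined over every commutative ring at once, so that it makes sense for integers, reals,
  \<open>k\<close> and polynomials alike. The enumeration chosen by \<open>SOME\<close> depends on
  \<open>n\<close> only, which lets ring homomorphisms carry one discriminant to another.\<close>

definition discriminant :: "nat \<Rightarrow> 'k::comm_ring_1 \<Rightarrow> 'k \<Rightarrow> 'k" where
  "discriminant n q1 q2 =
    det (mat_on (SOME bs. distinct bs \<and> set bs = ramified_partitions n)
      (trace_form (ramified_partitions n) (comp2 n) (weight2 n q1 q2)))"

lemma discriminant_hom:
  assumes "comm_ring_hom h"
  shows "discriminant n (h q1) (h q2) = h (discriminant n q1 q2)"
proof -
  interpret comm_ring_hom h by fact
  have "weight2 n (h q1) (h q2) = (\<lambda>a b. h (weight2 n q1 q2 a b))"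
    by (simp add: weight2_def fun_eq_iff hom_distribs)
  then show ?thesis
    unfolding discriminant_def
    by (simp only: trace_form_hom[OF assms] det_mat_on_hom[OF assms])
qed

lemma enumeration_ramified:
  fixes n :: nat
  defines "bs \<equiv> SOME bs. distinct bs \<and> set bs = ramified_partitions n"
  shows "distinct bs" "set bs = ramified_partitions n"
proof -
  have "\<exists>bs. distinct bs \<and> set bs = ramified_partitions n"
    using finite_distinct_list[OF finite_ramified_partitions[of n]] by blast
  then have "distinct bs \<and> set bs = ramified_partitions n"
    unfolding bs_def by (rule someI_ex)
  then show "distinct bs" "set bs = ramified_partitions n" by simp_all
qed

lemma discriminant_real_nonzero:
  assumes "2 * n \<le> N"
  shows "discriminant n (of_nat N :: real) (of_nat N) \<noteq> 0"
proof -
  interpret star_representation "ramified_partitions n" "comp2 n" "weight2 n (of_nat N) (of_nat N)" "unit2 n"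
    "words n N \<times> words n N" entry2 "\<lambda>a. (flip (fst a), flip (snd a))"
    by (rule star_representation_ramified[OF assms])
  show ?thesis
    unfolding discriminant_def
  proof (rule det_mat_on_nonzero[OF enumeration_ramified(1)], unfold enumeration_ramified(2))
    show "v b = 0" if "\<And>a. a \<in> ramified_partitions n \<Longrightarrow> (\<Sum>b\<in>ramified_partitions n. T a b * v b) = 0"
      "b \<in> ramified_partitions n" for v b
      using that by (rule trace_form_kernel)
  qed
qed

text \<open>At natural parameters the reals and \<open>k\<close> both receive the image of the same
  integer. It is nonzero because its real image is, and characteristic zero keeps it nonzero in
  \<open>k\<close>.\<close>

lemma discriminant_nonzero:
  assumes "2 * n \<le> N"
  shows "discriminant n (of_nat N :: 'k::field_char_0) (of_nat N) \<noteq> 0"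
proof -
  have hom: "comm_ring_hom (of_int :: int \<Rightarrow> 'r::comm_ring_1)" by standard simp_all
  have "of_int (discriminant n (of_nat N) (of_nat N)) = discriminant n (of_nat N :: real) (of_nat N)"
    using discriminant_hom[OF hom, of n "of_nat N" "of_nat N", where 'b=real] by simp
  then have "discriminant n (of_nat N :: int) (of_nat N) \<noteq> 0"
    using discriminant_real_nonzero[OF assms] by (metis of_int_0)
  moreover have "of_int (discriminant n (of_nat N) (of_nat N)) = discriminant n (of_nat N :: 'k) (of_nat N)"
    using discriminant_hom[OF hom, of n "of_nat N" "of_nat N", where 'b='k] by simp
  ultimately show ?thesis by (metis of_int_eq_0_iff)
qed

lemma semisimple_of_discriminant:
  fixes Q1 Q2 :: "'k::field"
  assumes "discriminant n Q1 Q2 \<noteq> 0"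
  shows "semisimple_algebra (ring_of_type_algebra :: 'k ring) (ramified_partition_algebra n Q1 Q2)"
proof -
  interpret twisted_monoid "ramified_partitions n" "comp2 n" "weight2 n Q1 Q2" "unit2 n"
    by (rule twisted_monoid_ramified)
  obtain s where s: "\<And>a c. a \<in> ramified_partitions n \<Longrightarrow> c \<in> ramified_partitions n \<Longrightarrow>
      matmul (ramified_partitions n) T s a c = of_bool (a = c)"
    using right_inverse_of_det[OF enumeration_ramified(1) assms[unfolded discriminant_def]]
    unfolding enumeration_ramified(2) by blast
  interpret nondegenerate_twisted_monoid "ramified_partitions n" "comp2 n" "weight2 n Q1 Q2" "unit2 n" s
    by unfold_locales (rule s)
  show ?thesis unfolding ramified_partition_algebra_eq by (rule semisimple_alg)
qed

theorem theorem1: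
  fixes n :: nat
  assumes "n \<ge> 1"
  shows "\<exists>f :: 'k::field_char_0 poly poly. f \<noteq> 0 \<and>
    (\<forall>Q1 Q2. poly (poly f [:Q2:]) Q1 \<noteq> 0 \<longrightarrow>
      semisimple_algebra (ring_of_type_algebra :: 'k ring) (ramified_partition_algebra n Q1 Q2))"
proof -
  \<comment> \<open>\<open>Q1\<close> is the variable of the coefficients and \<open>Q2\<close> the outer variable.\<close>
  define f :: "'k poly poly" where "f = discriminant n [:[:0, 1:]:] [:0, 1:]"
  have f: "poly (poly f [:Q2:]) Q1 = discriminant n Q1 Q2" for Q1 Q2
  proof -
    \<comment> \<open>Evaluation at the two parameters is a ring homomorphism sending the two
      variables to \<open>Q1\<close> and \<open>Q2\<close>.\<close>
    have "comm_ring_hom (\<lambda>f. poly (poly f [:Q2:]) Q1)" by standard simp_all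
    from discriminant_hom[OF this, of n "[:[:0, 1:]:]" "[:0, 1:]"] show ?thesis
      by (simp add: f_def)
  qed
  \<comment> \<open>The least number of colours for which linear independence was shown.\<close>
  have "poly (poly f [:of_nat (2 * n):]) (of_nat (2 * n)) \<noteq> 0"
    unfolding f by (rule discriminant_nonzero) simp
  then have "f \<noteq> 0" by auto
  then show ?thesis
    by (intro exI[of _ f] conjI allI impI semisimple_of_discriminant) (simp_all only: f not_False_eq_True)
qed

end
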